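(* Let $(\sigma_h^{n+1},u_h^{n+1},\gamma_h^{n+1},z_h^{n+1},p_h^{n+1})_{0\le n\le N-1}$ be the solution of the drained split scheme: $(\sigma_h^{n+1},u_h^{n+1},\gamma_h^{n+1},z_h^{n+1},p_h^{n+1})\in\mathbb{X}_h\times V_h\times\mathbb{Q}_h\times Z_h\times W_h$ satisfy, for $n=-1,0,\dots,N-1$ with $p_h^{-1}:=p_h^0$, $$\begin{aligned} &(A\sigma_h^{n+1},\tau)+(u_h^{n+1},\mathrm{div}\,\tau)+(\gamma_h^{n+1},\tau)=-(A\alpha p_h^nI,\tau)&&\forall\tau\in\mathbb{X}_h,\\ &(\mathrm{div}\,\sigma_h^{n+1},v)=0&&\forall v\in V_h,\\ &(\sigma_h^{n+1},\xi)=0&&\forall\xi\in\mathbb{Q}_h,\\ &(K^{-1}z_h^{n+1},q)-(p_h^{n+1},\mathrm{div}\,q)=0&&\forall q\in Z_h, \end{aligned}$$ and, for $n=0,\dots,N-1$ and all $w\in W_h$, $$c_0\Big(\frac{p_h^{n+1}-p_h^n}{\Delta t},w\Big)+\alpha\Big(A\alpha\frac{p_h^{n+1}-p_h^n}{\Delta t}I,wI\Big)+(\mathrm{div}\,z_h^{n+1},w)=-\alpha\Big(A\frac{\sigma_h^{n+1}-\sigma_h^n}{\Delta t},wI\Big).$$ Then there exists a constant $C$ independent of $h$, $\Delta t$, $c_0$, and $a_{\min}$ such that $$\sum_{n=0}^{N-1}\frac{c_0}{\Delta t}\|p_h^{n+1}-p_h^n\|^2+\max_{0\le n\le N-1}\Big(\|z_h^{n+1}\|^2+\|p_h^{n+1}\|^2+\|A^{1/2}\sigma_h^{n+1}\|^2+\|u_h^{n+1}\|^2+\|\gamma_h^{n+1}\|^2\Big)\le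 C\big(\|p_h^0\|^2+\|z_h^0\|^2\big).$$
   Context: $\Omega\subset\mathbb{R}^d$, $d=2,3$, is a simply connected Lipschitz polygonal domain with $\partial\Omega=\Gamma_D^u\cup\Gamma_N^\sigma=\Gamma_D^p\cup\Gamma_N^z$. $\mathbb{M},\mathbb{S},\mathbb{N}$ are the real $d\times d$ matrices, symmetric matrices, and skew-symmetric matrices. $(\cdot,\cdot)$ and $\|\cdot\|$ are the $L^2(\Omega)$ inner product and norm (scalar, vector or matrix valued); $\mathrm{div}$ of a matrix field is taken row-wise; $\|\tau\|_{\mathrm{div}}^2=\|\tau\|^2+\|\mathrm{div}\,\tau\|^2$; $I$ is the $d\times d$ identity. $A$ (compliance tensor) is a symmetric, bounded, uniformly positive definite linear operator on $\mathbb{S}$, extended to $\mathbb{M}$, and $K$ (permeability) is a symmetric, bounded, uniformly positive definite tensor: there are constants $0<a_{\min}\le a_{\max}<\infty$, $0<k_{\min}\le k_{\max}<\infty$ with $a_{\min}\|\tau\|^2\le(A\tau,\tau)\le a_{\max}\|\tau\|^2$ for all $\tau\in\mathbb{X}$ and $k_{\min}\|q\|^2\le(Kq,q)\le k_{\max}\|q\|^2$ for all $q\in Z$. Also $c_0\ge0$, $0<\alpha\le1$, and $\Delta t=T/N$ is the time step. Spaces: $\mathbb{X}=\{\tau\in H(\mathrm{div};\Omega,\mathbb{M}):\tau n=0\text{ on }\Gamma_N^\sigma\}$, $V=L^2(\Omega,\mathbb{R}^d)$, $\mathbb{Q}=L^2(\Omega,\mathbb{N})$, $Z=\{q\in H(\mathrm{div};\Omega):q\cdot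 n=0\text{ on }\Gamma_N^z\}$, $W=L^2(\Omega)$, where $n$ here denotes the outward unit normal on $\partial\Omega$. $\mathbb{X}_h\times V_h\times\mathbb{Q}_h\times Z_h\times W_h\subset\mathbb{X}\times V\times\mathbb{Q}\times Z\times W$ are finite element spaces on a shape-regular quasi-uniform family of partitions $\mathcal T_h$ of $\Omega$ with mesh size $h$, satisfying the inf-sup conditions, with constants independent of $h$, $$\|v\|+\|\xi\|\le C\sup_{0\ne\tau\in\mathbb{X}_h}\frac{(v,\mathrm{div}\,\tau)+(\xi,\tau)}{\|\tau\|_{\mathrm{div}}}\ \ \forall v\in V_h,\xi\in\mathbb{Q}_h,\qquad \|w\|\le C\sup_{0\ne q\in Z_h}\frac{(\mathrm{div}\,q,w)}{\|q\|_{\mathrm{div}}}\ \ \forall w\in W_h.$$ $p_h^0\in W_h$ is the given discrete initial pressure. Source terms and boundary data are zero. Solving the first four equations with $n=-1$ provides the initial data $\sigma_h^0,u_h^0,\gamma_h^0,z_h^0$. *)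

theory Defs
  imports "HOL-Analysis.Analysis"
begin

section \<open>The domain\<close>

text \<open>Near every boundary point the domain is the part of a ball lying above the graph of a Lipschitz
  function over the hyperplane orthogonal to a unit vector \<open>e\<close>; \<open>y - (y \<bullet> e) *\<^sub>R e\<close> is the orthogonal
  projection of \<open>y\<close> onto that hyperplane.\<close>

definition lipschitz_boundary :: "(real ^ 'n) set \<Rightarrow> bool" where
  "lipschitz_boundary \<Omega> \<longleftrightarrow>
     (\<forall>x\<in>frontier \<Omega>. \<exists>r>0. \<exists>e. norm e = 1 \<and> (\<exists>L g. L-lipschitz_on UNIV g \<and>
        \<Omega> \<inter> ball x r = {y \<in> ball x r. (g (y - (y \<bullet> e) *\<^sub>R e) :: real) < y \<bullet> e}))"

definition polygonal_domain :: "(real ^ 'n) set \<Rightarrow> bool" where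
  "polygonal_domain \<Omega> \<longleftrightarrow>
     open \<Omega> \<and> bounded \<Omega> \<and> \<Omega> \<noteq> {} \<and> simply_connected \<Omega> \<and> lipschitz_boundary \<Omega> \<and>
     (\<exists>F. finite F \<and> (\<forall>P\<in>F. polytope P) \<and> closure \<Omega> = \<Union>F)"

section \<open>Square-integrable fields\<close>

text \<open>Elements of \<open>L\<^sup>2(\<Omega>)\<close> are represented by functions on the whole space; only the values on \<open>\<Omega>\<close>, up to
  a null set, matter. For matrix-valued fields the inner product of the type \<open>real ^ 'n ^ 'n\<close> is the
  Frobenius product.\<close>

definition L2 :: "(real ^ 'n) set \<Rightarrow> (real ^ 'n \<Rightarrow> 'b::euclidean_space) set" where
  "L2 \<Omega> = {f. f \<in> borel_measurable (lebesgue_on \<Omega>) \<and>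
              integrable (lebesgue_on \<Omega>) (\<lambda>x. (norm (f x))\<^sup>2)}"

definition ip :: "(real ^ 'n) set \<Rightarrow> (real ^ 'n \<Rightarrow> 'b::euclidean_space) \<Rightarrow> (real ^ 'n \<Rightarrow> 'b) \<Rightarrow> real" where
  "ip \<Omega> f g = (LINT x|lebesgue_on \<Omega>. f x \<bullet> g x)"

definition nrm :: "(real ^ 'n) set \<Rightarrow> (real ^ 'n \<Rightarrow> 'b::euclidean_space) \<Rightarrow> real" where
  "nrm \<Omega> f = sqrt (ip \<Omega> f f)"

section \<open>Weak divergence and normal traces\<close>

definition C1_with_grad :: "(real ^ 'n \<Rightarrow> real) \<Rightarrow> (real ^ 'n \<Rightarrow> real ^ 'n) \<Rightarrow> bool" where
  "C1_with_grad \<phi> g \<longleftrightarrow>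
     (\<forall>x. (\<phi> has_derivative (\<lambda>h. g x \<bullet> h)) (at x)) \<and> continuous_on UNIV g"

definition is_weak_div :: "(real ^ 'n) set \<Rightarrow> (real ^ 'n \<Rightarrow> real ^ 'n) \<Rightarrow> (real ^ 'n \<Rightarrow> real) \<Rightarrow> bool" where
  "is_weak_div \<Omega> q d \<longleftrightarrow> d \<in> L2 \<Omega> \<and>
     (\<forall>\<phi> g. C1_with_grad \<phi> g \<and> compact (closure {x. \<phi> x \<noteq> 0}) \<and> closure {x. \<phi> x \<noteq> 0} \<subseteq> \<Omega> \<longrightarrow>
        ip \<Omega> q g = - ip \<Omega> d \<phi>)"

text \<open>The weak divergence is unique up to a null set, so the choice is immaterial.\<close>

definition wdiv :: "(real ^ 'n) set \<Rightarrow> (real ^ 'n \<Rightarrow> real ^ 'n) \<Rightarrow> real ^ 'n \<Rightarrow> real" where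
  "wdiv \<Omega> q = (SOME d. is_weak_div \<Omega> q d)"

definition Hdiv :: "(real ^ 'n) set \<Rightarrow> (real ^ 'n \<Rightarrow> real ^ 'n) set" where
  "Hdiv \<Omega> = {q \<in> L2 \<Omega>. \<exists>d. is_weak_div \<Omega> q d}"

text \<open>The normal trace of an \<open>H(div)\<close> field is the functional
  \<open>\<langle>q \<cdot> n, \<phi>\<rangle> = (q, \<nabla>\<phi>) + (div q, \<phi>)\<close> given by Green's formula, where \<open>n\<close> is the outward unit normal.
  It vanishes on \<open>\<Gamma>\<close> if it vanishes on all test functions that are zero on the rest of the boundary.\<close>

definition zero_normal_trace :: "(real ^ 'n) set \<Rightarrow> (real ^ 'n) set \<Rightarrow> (real ^ 'n \<Rightarrow> real ^ 'n) \<Rightarrow> bool" where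
  "zero_normal_trace \<Omega> \<Gamma> q \<longleftrightarrow>
     (\<forall>\<phi> g. C1_with_grad \<phi> g \<and> (\<forall>x\<in>frontier \<Omega> - \<Gamma>. \<phi> x = 0) \<longrightarrow>
        ip \<Omega> q g + ip \<Omega> (wdiv \<Omega> q) \<phi> = 0)"

text \<open>Row \<open>i\<close> of a matrix \<open>M :: real ^ 'n ^ 'n\<close> is \<open>M $ i\<close>.\<close>

definition mdiv :: "(real ^ 'n) set \<Rightarrow> (real ^ 'n \<Rightarrow> real ^ 'n ^ 'n) \<Rightarrow> real ^ 'n \<Rightarrow> real ^ 'n" where
  "mdiv \<Omega> \<tau> x = (\<chi> i. wdiv \<Omega> (\<lambda>y. \<tau> y $ i) x)"

definition hdiv_norm :: "(real ^ 'n) set \<Rightarrow> (real ^ 'n \<Rightarrow> real ^ 'n) \<Rightarrow> real" where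
  "hdiv_norm \<Omega> q = sqrt ((nrm \<Omega> q)\<^sup>2 + (nrm \<Omega> (wdiv \<Omega> q))\<^sup>2)"

definition mhdiv_norm :: "(real ^ 'n) set \<Rightarrow> (real ^ 'n \<Rightarrow> real ^ 'n ^ 'n) \<Rightarrow> real" where
  "mhdiv_norm \<Omega> \<tau> = sqrt ((nrm \<Omega> \<tau>)\<^sup>2 + (nrm \<Omega> (mdiv \<Omega> \<tau>))\<^sup>2)"

section \<open>The continuous spaces\<close>

definition X_space :: "(real ^ 'n) set \<Rightarrow> (real ^ 'n) set \<Rightarrow> (real ^ 'n \<Rightarrow> real ^ 'n ^ 'n) set" where
  "X_space \<Omega> \<Gamma> = {\<tau>. \<forall>i. (\<lambda>x. \<tau> x $ i) \<in> Hdiv \<Omega> \<and> zero_normal_trace \<Omega> \<Gamma> (\<lambda>x. \<tau> x $ i)}"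

definition Z_space :: "(real ^ 'n) set \<Rightarrow> (real ^ 'n) set \<Rightarrow> (real ^ 'n \<Rightarrow> real ^ 'n) set" where
  "Z_space \<Omega> \<Gamma> = {q \<in> Hdiv \<Omega>. zero_normal_trace \<Omega> \<Gamma> q}"

definition Q_space :: "(real ^ 'n) set \<Rightarrow> (real ^ 'n \<Rightarrow> real ^ 'n ^ 'n) set" where
  "Q_space \<Omega> = {\<xi> \<in> L2 \<Omega>. AE x in lebesgue_on \<Omega>. transpose (\<xi> x) = - \<xi> x}"

section \<open>Partitions and finite element spaces\<close>

definition is_partition :: "(real ^ 'n) set \<Rightarrow> (real ^ 'n) set set \<Rightarrow> bool" where
  "is_partition \<Omega> \<T> \<longleftrightarrow>
     finite \<T> \<and> \<Union>\<T> = closure \<Omega> \<and>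
     (\<forall>E\<in>\<T>. polytope E \<and> interior E \<noteq> {}) \<and>
     (\<forall>E\<in>\<T>. \<forall>E'\<in>\<T>. E \<noteq> E' \<longrightarrow> interior E \<inter> interior E' = {})"

definition mesh_size :: "(real ^ 'n) set set \<Rightarrow> real" where
  "mesh_size \<T> = Max (diameter ` \<T>)"

text \<open>A family of partitions indexed by its mesh sizes \<open>h \<in> H\<close>.\<close>

definition partition_family :: "(real ^ 'n) set \<Rightarrow> real set \<Rightarrow> (real \<Rightarrow> (real ^ 'n) set set) \<Rightarrow> bool" where
  "partition_family \<Omega> H \<T> \<longleftrightarrow> (\<forall>h\<in>H. 0 < h \<and> is_partition \<Omega> (\<T> h) \<and> mesh_size (\<T> h) = h)"

definition shape_regular :: "real set \<Rightarrow> (real \<Rightarrow> (real ^ 'n) set set) \<Rightarrow> bool" where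
  "shape_regular H \<T> \<longleftrightarrow>
     (\<exists>\<rho>>0. \<forall>h\<in>H. \<forall>E\<in>\<T> h. \<exists>c. ball c (\<rho> * diameter E) \<subseteq> E)"

definition quasi_uniform :: "real set \<Rightarrow> (real \<Rightarrow> (real ^ 'n) set set) \<Rightarrow> bool" where
  "quasi_uniform H \<T> \<longleftrightarrow> (\<exists>\<rho>>0. \<forall>h\<in>H. \<forall>E\<in>\<T> h. \<rho> * h \<le> diameter E)"

text \<open>Finite-dimensional spaces of functions that are continuously differentiable inside every element. The local
  functions are not required to be polynomials, as mapped elements also yield rational ones.\<close>

definition fe_space :: "(real ^ 'n) set set \<Rightarrow> (real ^ 'n \<Rightarrow> 'b::euclidean_space) set \<Rightarrow> bool" where
  "fe_space \<T> S \<longleftrightarrow>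
     (\<exists>(m::nat) b. S = {f. \<exists>c :: nat \<Rightarrow> real. f = (\<lambda>x. \<Sum>i<m. c i *\<^sub>R b i x)}) \<and>
     (\<forall>f\<in>S. \<forall>E\<in>\<T>. \<exists>f' :: real ^ 'n \<Rightarrow> (real ^ 'n) \<Rightarrow>\<^sub>L 'b.
        continuous_on (interior E) f' \<and>
        (\<forall>x\<in>interior E. (f has_derivative blinfun_apply (f' x)) (at x)))"

definition inf_sup_elasticity ::
  "(real ^ 'n) set \<Rightarrow> (real ^ 'n \<Rightarrow> real ^ 'n ^ 'n) set \<Rightarrow> (real ^ 'n \<Rightarrow> real ^ 'n) set \<Rightarrow>
   (real ^ 'n \<Rightarrow> real ^ 'n ^ 'n) set \<Rightarrow> real \<Rightarrow> bool" where
  "inf_sup_elasticity \<Omega> Xh Vh Qh C \<longleftrightarrow>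
     (\<forall>v\<in>Vh. \<forall>\<xi>\<in>Qh. nrm \<Omega> v + nrm \<Omega> \<xi> \<le>
        C * (SUP \<tau>\<in>{\<tau>\<in>Xh. mhdiv_norm \<Omega> \<tau> \<noteq> 0}.
               (ip \<Omega> v (mdiv \<Omega> \<tau>) + ip \<Omega> \<xi> \<tau>) / mhdiv_norm \<Omega> \<tau>))"

definition inf_sup_flow ::
  "(real ^ 'n) set \<Rightarrow> (real ^ 'n \<Rightarrow> real ^ 'n) set \<Rightarrow> (real ^ 'n \<Rightarrow> real) set \<Rightarrow> real \<Rightarrow> bool" where
  "inf_sup_flow \<Omega> Zh Wh C \<longleftrightarrow>
     (\<forall>w\<in>Wh. nrm \<Omega> w \<le>
        C * (SUP q\<in>{q\<in>Zh. hdiv_norm \<Omega> q \<noteq> 0}. ip \<Omega> (wdiv \<Omega> q) w / hdiv_norm \<Omega> q))"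

section \<open>Coefficients\<close>

text \<open>\<open>X\<close> is the space of matrix fields on which the two-sided bound is imposed.\<close>

definition compliance_tensor ::
  "(real ^ 'n) set \<Rightarrow> (real ^ 'n \<Rightarrow> real ^ 'n ^ 'n) set \<Rightarrow> real \<Rightarrow> real \<Rightarrow>
   (real ^ 'n \<Rightarrow> real ^ 'n ^ 'n \<Rightarrow> real ^ 'n ^ 'n) \<Rightarrow> bool" where
  "compliance_tensor \<Omega> X a_min a_max A \<longleftrightarrow>
     (\<forall>x\<in>\<Omega>. linear (A x)) \<and>
     (\<forall>M. (\<lambda>x. A x M) \<in> borel_measurable (lebesgue_on \<Omega>)) \<and>
     (\<forall>x\<in>\<Omega>. \<forall>M. transpose M = M \<longrightarrow> transpose (A x M) = A x M) \<and>
     (\<forall>x\<in>\<Omega>. \<forall>M N. A x M \<bullet> N = M \<bullet> A x N) \<and>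
     (\<exists>B. AE x in lebesgue_on \<Omega>. \<forall>M. norm (A x M) \<le> B * norm M) \<and>
     (\<forall>\<tau>\<in>X. a_min * (nrm \<Omega> \<tau>)\<^sup>2 \<le> ip \<Omega> (\<lambda>x. A x (\<tau> x)) \<tau> \<and>
              ip \<Omega> (\<lambda>x. A x (\<tau> x)) \<tau> \<le> a_max * (nrm \<Omega> \<tau>)\<^sup>2)"

definition permeability_tensor ::
  "(real ^ 'n) set \<Rightarrow> (real ^ 'n \<Rightarrow> real ^ 'n) set \<Rightarrow> real \<Rightarrow> real \<Rightarrow>
   (real ^ 'n \<Rightarrow> real ^ 'n ^ 'n) \<Rightarrow> bool" where
  "permeability_tensor \<Omega> Z k_min k_max K \<longleftrightarrow>
     K \<in> borel_measurable (lebesgue_on \<Omega>) \<and>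
     (\<forall>x\<in>\<Omega>. transpose (K x) = K x) \<and>
     (\<exists>B. AE x in lebesgue_on \<Omega>. norm (K x) \<le> B) \<and>
     (\<forall>q\<in>Z. k_min * (nrm \<Omega> q)\<^sup>2 \<le> ip \<Omega> (\<lambda>x. K x *v q x) q \<and>
             ip \<Omega> (\<lambda>x. K x *v q x) q \<le> k_max * (nrm \<Omega> q)\<^sup>2)"

text \<open>The symmetric positive semidefinite square root of a symmetric positive semidefinite operator; it
  exists and is unique. The field \<open>A\<^sup>1\<^sup>/\<^sup>2\<close> is obtained pointwise (\<open>A x\<close> is positive definite for almost
  every \<open>x\<close>).\<close>

definition op_sqrt :: "('b::euclidean_space \<Rightarrow> 'b) \<Rightarrow> 'b \<Rightarrow> 'b" where
  "op_sqrt B = (SOME R. linear R \<and> (\<forall>M N. R M \<bullet> N = M \<bullet> R N) \<and> (\<forall>M. 0 \<le> R M \<bullet> M) \<and>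
                        (\<forall>M. R (R M) = B M))"

section \<open>The drained split scheme\<close>

text \<open>The four equations of one time level without time differences; \<open>p'\<close> is the lagged pressure.\<close>

definition level_equations ::
  "(real ^ 'n) set \<Rightarrow> (real ^ 'n \<Rightarrow> real ^ 'n ^ 'n \<Rightarrow> real ^ 'n ^ 'n) \<Rightarrow> (real ^ 'n \<Rightarrow> real ^ 'n ^ 'n) \<Rightarrow> real \<Rightarrow>
   (real ^ 'n \<Rightarrow> real ^ 'n ^ 'n) set \<Rightarrow> (real ^ 'n \<Rightarrow> real ^ 'n) set \<Rightarrow>
   (real ^ 'n \<Rightarrow> real ^ 'n ^ 'n) set \<Rightarrow> (real ^ 'n \<Rightarrow> real ^ 'n) set \<Rightarrow> 
   (real ^ 'n \<Rightarrow> real) \<Rightarrow> (real ^ 'n \<Rightarrow> real ^ 'n ^ 'n) \<Rightarrow> (real ^ 'n \<Rightarrow> real ^ 'n) \<Rightarrow>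
   (real ^ 'n \<Rightarrow> real ^ 'n ^ 'n) \<Rightarrow> (real ^ 'n \<Rightarrow> real ^ 'n) \<Rightarrow> (real ^ 'n \<Rightarrow> real) \<Rightarrow> bool" where
  "level_equations \<Omega> A K \<alpha> Xh Vh Qh Zh p' \<sigma> u \<gamma> z p \<longleftrightarrow>
     (\<forall>\<tau>\<in>Xh. ip \<Omega> (\<lambda>x. A x (\<sigma> x)) \<tau> + ip \<Omega> u (mdiv \<Omega> \<tau>) + ip \<Omega> \<gamma> \<tau>
               = - ip \<Omega> (\<lambda>x. A x ((\<alpha> * p' x) *\<^sub>R mat 1)) \<tau>) \<and>
     (\<forall>v\<in>Vh. ip \<Omega> (mdiv \<Omega> \<sigma>) v = 0) \<and>
     (\<forall>\<xi>\<in>Qh. ip \<Omega> \<sigma> \<xi> = 0) \<and>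
     (\<forall>q\<in>Zh. ip \<Omega> (\<lambda>x. matrix_inv (K x) *v z x) q - ip \<Omega> p (wdiv \<Omega> q) = 0)"

text \<open>Index \<open>k\<close> of the sequences is the time level \<open>k = n + 1\<close>. Level \<open>0\<close> (the case \<open>n = -1\<close>) uses the
  lagged pressure \<open>p\<^sup>-\<^sup>1 = p\<^sup>0\<close>.\<close>

definition drained_split_solution ::
  "(real ^ 'n) set \<Rightarrow> (real ^ 'n \<Rightarrow> real ^ 'n ^ 'n \<Rightarrow> real ^ 'n ^ 'n) \<Rightarrow> (real ^ 'n \<Rightarrow> real ^ 'n ^ 'n) \<Rightarrow> real \<Rightarrow>
   real \<Rightarrow> real \<Rightarrow> nat \<Rightarrow>
   (real ^ 'n \<Rightarrow> real ^ 'n ^ 'n) set \<Rightarrow> (real ^ 'n \<Rightarrow> real ^ 'n) set \<Rightarrow>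
   (real ^ 'n \<Rightarrow> real ^ 'n ^ 'n) set \<Rightarrow> (real ^ 'n \<Rightarrow> real ^ 'n) set \<Rightarrow> (real ^ 'n \<Rightarrow> real) set \<Rightarrow>
   (nat \<Rightarrow> real ^ 'n \<Rightarrow> real ^ 'n ^ 'n) \<Rightarrow> (nat \<Rightarrow> real ^ 'n \<Rightarrow> real ^ 'n) \<Rightarrow>
   (nat \<Rightarrow> real ^ 'n \<Rightarrow> real ^ 'n ^ 'n) \<Rightarrow> (nat \<Rightarrow> real ^ 'n \<Rightarrow> real ^ 'n) \<Rightarrow>
   (nat \<Rightarrow> real ^ 'n \<Rightarrow> real) \<Rightarrow> bool" where
  "drained_split_solution \<Omega> A K \<alpha> c\<^sub>0 \<Delta>t N Xh Vh Qh Zh Wh \<sigma> u \<gamma> z p \<longleftrightarrow>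
     (\<forall>k\<le>N. \<sigma> k \<in> Xh \<and> u k \<in> Vh \<and> \<gamma> k \<in> Qh \<and> z k \<in> Zh \<and> p k \<in> Wh) \<and>
     level_equations \<Omega> A K \<alpha> Xh Vh Qh Zh (p 0) (\<sigma> 0) (u 0) (\<gamma> 0) (z 0) (p 0) \<and>
     (\<forall>n<N. level_equations \<Omega> A K \<alpha> Xh Vh Qh Zh (p n)
              (\<sigma> (Suc n)) (u (Suc n)) (\<gamma> (Suc n)) (z (Suc n)) (p (Suc n))) \<and>
     (\<forall>n<N. \<forall>w\<in>Wh.
        c\<^sub>0 * ip \<Omega> (\<lambda>x. (p (Suc n) x - p n x) / \<Delta>t) w
        + \<alpha> * ip \<Omega> (\<lambda>x. A x ((\<alpha> * ((p (Suc n) x - p n x) / \<Delta>t)) *\<^sub>R mat 1)) (\<lambda>x. w x *\<^sub>R mat 1)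
        + ip \<Omega> (wdiv \<Omega> (z (Suc n))) w
        = - \<alpha> * ip \<Omega> (\<lambda>x. A x ((1 / \<Delta>t) *\<^sub>R (\<sigma> (Suc n) x - \<sigma> n x))) (\<lambda>x. w x *\<^sub>R mat 1))"

end

theory Submission
  imports Defs
begin

text \<open>The scheme is stable because of one energy identity. Test the storage equation with the pressure
  increment \<open>p\<^sup>n\<^sup>+\<^sup>1 - p\<^sup>n\<close>. The storage term gives \<open>c\<^sub>0 / \<Delta>t\<close> times its squared norm, the second term gives
  \<open>e\<^sub>n\<^sub>+\<^sub>1 / \<Delta>t\<close> with \<open>e\<^sub>k = \<parallel>A\<^sup>1\<^sup>/\<^sup>2 \<alpha> (p\<^sup>k - p\<^sup>k\<^sup>-\<^sup>1) I\<parallel>\<^sup>2\<close>, and by the difference of two Darcy equations the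
  divergence term is at least half the increment of \<open>(K\<^sup>-\<^sup>1 z, z)\<close>. On the right stands the product of the
  stress increment with \<open>\<alpha> (p\<^sup>n\<^sup>+\<^sup>1 - p\<^sup>n) I\<close> in the \<open>A\<close>-inner product. The stress equation uses the lagged pressure,
  so the \<open>A\<close>-norm of the stress increment is at most the square root of \<open>e\<^sub>n\<close>, and Young's inequality
  bounds the right-hand side by \<open>(e\<^sub>n + e\<^sub>n\<^sub>+\<^sub>1) / (2 \<Delta>t)\<close>. What remains telescopes, and \<open>e\<^sub>0 = 0\<close>
  (\<open>storage_step\<close>, \<open>energy_estimate\<close>). This bounds the storage sum and every flux by the initial flux.
  The inf-sup condition of the flow problem then bounds the pressures by the fluxes, the stress equation
  bounds the stresses by the pressures, and the inf-sup condition of elasticity bounds displacement and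
  rotation. The terms with \<open>A\<close> are estimated by positivity and the upper bound \<open>a_max\<close> alone, which makes the
  constant independent of \<open>a_min\<close>.

  The coefficient bounds are given only in integrated form and only for fields in the spaces \<open>X\<close> and
  \<open>Z\<close>, but the argument applies \<open>A\<close> to \<open>p I\<close>, which need not lie in \<open>X\<close>, inverts \<open>K\<close> pointwise and takes
  pointwise square roots of \<open>A\<close>. The integrated bounds are therefore localised: fields \<open>\<phi> v\<close> with a compactly
  supported \<open>C\<^sup>1\<close> function \<open>\<phi>\<close> belong to both kinds of spaces (\<open>test_field_in_Z_space\<close>), and by Lebesgue
  differentiation they see the coefficient at almost every point (\<open>coefficient_field_from_test_fields\<close>).\<close>

section \<open>The inner product of square-integrable fields\<close>

lemma L2_D:
  assumes "f \<in> L2 \<Omega>"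
  shows L2_measurable: "f \<in> borel_measurable (lebesgue_on \<Omega>)"
    and L2_integrable: "integrable (lebesgue_on \<Omega>) (\<lambda>x. (norm (f x))\<^sup>2)"
  using assms by (auto simp: L2_def)

lemma L2_dominated:
  assumes "f \<in> L2 \<Omega>" "g \<in> borel_measurable (lebesgue_on \<Omega>)"
    and "AE x in lebesgue_on \<Omega>. norm (g x) \<le> B * norm (f x)"
  shows "g \<in> L2 \<Omega>"
proof -
  have "integrable (lebesgue_on \<Omega>) (\<lambda>x. (norm (g x))\<^sup>2)"
  proof (rule Bochner_Integration.integrable_bound)
    show "integrable (lebesgue_on \<Omega>) (\<lambda>x. B\<^sup>2 * (norm (f x))\<^sup>2)"
      using L2_integrable[OF assms(1)] by simp
    show "AE x in lebesgue_on \<Omega>. norm ((norm (g x))\<^sup>2) \<le> norm (B\<^sup>2 * (norm (f x))\<^sup>2)"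
      using assms(3)
    proof eventually_elim
      case (elim x)
      have "(norm (g x))\<^sup>2 \<le> (B * norm (f x))\<^sup>2"
        by (rule power_mono[OF elim]) simp
      then show ?case by (simp add: power_mult_distrib)
    qed
  qed (use assms(2) in measurable)
  with assms(2) show ?thesis by (simp add: L2_def)
qed

lemma L2_add:
  assumes "f \<in> L2 \<Omega>" "g \<in> L2 \<Omega>"
  shows "(\<lambda>x. f x + g x) \<in> L2 \<Omega>"
proof -
  note [measurable] = L2_measurable[OF assms(1)] L2_measurable[OF assms(2)]
  have "integrable (lebesgue_on \<Omega>) (\<lambda>x. (norm (f x + g x))\<^sup>2)"
  proof (rule Bochner_Integration.integrable_bound)
    show "integrable (lebesgue_on \<Omega>) (\<lambda>x. 2 * (norm (f x))\<^sup>2 + 2 * (norm (g x))\<^sup>2)"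
      using assms[THEN L2_integrable] by simp
    have "(norm (f x + g x))\<^sup>2 \<le> 2 * (norm (f x))\<^sup>2 + 2 * (norm (g x))\<^sup>2" for x
      using power2_norm_eq_inner[of "f x + g x"] power2_norm_eq_inner[of "f x - g x"]
        zero_le_power2[of "norm (f x - g x)"]
      by (simp add: inner_simps inner_commute power2_norm_eq_inner)
    then show "AE x in lebesgue_on \<Omega>. norm ((norm (f x + g x))\<^sup>2)
        \<le> norm (2 * (norm (f x))\<^sup>2 + 2 * (norm (g x))\<^sup>2)"
      by simp
  qed measurable
  then show ?thesis by (simp add: L2_def)
qed

lemma L2_scaleR:
  assumes "f \<in> L2 \<Omega>" shows "(\<lambda>x. c *\<^sub>R f x) \<in> L2 \<Omega>"
  using assms by (auto simp: L2_def power_mult_distrib)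

lemma L2_diff:
  assumes "f \<in> L2 \<Omega>" "g \<in> L2 \<Omega>"
  shows "(\<lambda>x. f x - g x) \<in> L2 \<Omega>"
  using L2_add[OF assms(1) L2_scaleR[OF assms(2), of "-1"]] by simp

lemma L2_scale_const:
  fixes p :: "real ^ 'n \<Rightarrow> real" and v :: "'b::euclidean_space"
  assumes "p \<in> L2 \<Omega>" shows "(\<lambda>x. p x *\<^sub>R v) \<in> L2 \<Omega>"
  by (rule L2_dominated[OF assms, where B = "norm v"]) (use L2_measurable[OF assms] in auto)

lemma borel_measurable_vec:
  fixes f :: "'a \<Rightarrow> 'b::euclidean_space ^ 'm"
  assumes "\<And>i. (\<lambda>x. f x $ i) \<in> borel_measurable M"
  shows "f \<in> borel_measurable M"
  unfolding borel_measurable_euclidean_space[of f]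
  using assms by (auto simp: Basis_vec_def inner_axis intro!: borel_measurable_inner)

lemma L2_components:
  fixes f :: "real ^ 'n \<Rightarrow> 'b::euclidean_space ^ 'm"
  assumes "\<And>i. (\<lambda>x. f x $ i) \<in> L2 \<Omega>"
  shows "f \<in> L2 \<Omega>"
proof -
  have "f \<in> borel_measurable (lebesgue_on \<Omega>)"
    by (rule borel_measurable_vec) (rule L2_measurable[OF assms])
  moreover have "integrable (lebesgue_on \<Omega>) (\<lambda>x. (norm (f x))\<^sup>2)"
    using L2_integrable[OF assms]
    by (simp add: norm_vec_def L2_set_def sum_nonneg)
  ultimately show ?thesis by (simp add: L2_def)
qed

lemma L2_integrable_inner:
  assumes "f \<in> L2 \<Omega>" "g \<in> L2 \<Omega>"
  shows "integrable (lebesgue_on \<Omega>) (\<lambda>x. f x \<bullet> g x)"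
proof (rule Bochner_Integration.integrable_bound)
  show "integrable (lebesgue_on \<Omega>) (\<lambda>x. (norm (f x))\<^sup>2 + (norm (g x))\<^sup>2)"
    using assms[THEN L2_integrable] by simp
  have "\<bar>f x \<bullet> g x\<bar> \<le> (norm (f x))\<^sup>2 + (norm (g x))\<^sup>2" for x
  proof -
    have "\<bar>f x \<bullet> g x\<bar> \<le> norm (f x) * norm (g x)" by (rule Cauchy_Schwarz_ineq2)
    also have "\<dots> \<le> (norm (f x))\<^sup>2 + (norm (g x))\<^sup>2"
    proof -
      have "0 \<le> norm (f x) * norm (g x)" by simp
      with sum_squares_bound[of "norm (f x)" "norm (g x)"] show ?thesis by linarith
    qed
    finally show ?thesis .
  qed
  then show "AE x in lebesgue_on \<Omega>. norm (f x \<bullet> g x) \<le> norm ((norm (f x))\<^sup>2 + (norm (g x))\<^sup>2)"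
    by simp
qed (use assms[THEN L2_measurable] in measurable)

lemma ip_commute: "ip \<Omega> f g = ip \<Omega> g f"
  by (simp add: ip_def inner_commute)

lemma ip_add_left:
  assumes "f \<in> L2 \<Omega>" "g \<in> L2 \<Omega>" "h \<in> L2 \<Omega>"
  shows "ip \<Omega> (\<lambda>x. f x + g x) h = ip \<Omega> f h + ip \<Omega> g h"
  using assms by (simp add: ip_def inner_add_left L2_integrable_inner)

lemma ip_diff_left:
  assumes "f \<in> L2 \<Omega>" "g \<in> L2 \<Omega>" "h \<in> L2 \<Omega>"
  shows "ip \<Omega> (\<lambda>x. f x - g x) h = ip \<Omega> f h - ip \<Omega> g h"
  using assms by (simp add: ip_def inner_diff_left L2_integrable_inner)

lemma ip_scaleR_left: "ip \<Omega> (\<lambda>x. c *\<^sub>R f x) h = c * ip \<Omega> f h"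
  by (simp add: ip_def)

lemma ip_scaleR_right: "ip \<Omega> f (\<lambda>x. c *\<^sub>R h x) = c * ip \<Omega> f h"
  by (simp add: ip_def)

lemma ip_self_nonneg: "0 \<le> ip \<Omega> f f"
  by (simp add: ip_def)

lemma nrm_nonneg: "0 \<le> nrm \<Omega> f"
  by (simp add: nrm_def ip_self_nonneg)

lemma nrm_power2: "(nrm \<Omega> f)\<^sup>2 = ip \<Omega> f f"
  by (simp add: nrm_def ip_self_nonneg)

lemma nrm_scaleR: "nrm \<Omega> (\<lambda>x. c *\<^sub>R f x) = \<bar>c\<bar> * nrm \<Omega> f"
proof -
  have "ip \<Omega> (\<lambda>x. c *\<^sub>R f x) (\<lambda>x. c *\<^sub>R f x) = c\<^sup>2 * ip \<Omega> f f"
    by (simp add: ip_def power2_eq_square mult.assoc)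
  then show ?thesis by (simp add: nrm_def real_sqrt_mult)
qed

lemma ip_cong_AE:
  assumes "f \<in> borel_measurable (lebesgue_on \<Omega>)" "f' \<in> borel_measurable (lebesgue_on \<Omega>)"
    and "g \<in> borel_measurable (lebesgue_on \<Omega>)"
    and "AE x in lebesgue_on \<Omega>. f x = f' x"
  shows "ip \<Omega> f g = ip \<Omega> f' g"
  unfolding ip_def using assms by (intro integral_cong_AE) auto

section \<open>Symmetric positive semidefinite operators\<close>

text \<open>The quadratic polynomial in \<open>t\<close> has no sign change. This is the source of all Cauchy--Schwarz
  inequalities below, for operators as well as for weighted inner products.\<close>

lemma discriminant_le:
  fixes a b c :: real
  assumes nonneg: "\<And>t. 0 \<le> a + 2 * t * b + t\<^sup>2 * c" and "0 \<le> c"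
  shows "b\<^sup>2 \<le> a * c"
proof (cases "c = 0")
  case True
  \<comment> \<open>A nonconstant affine function of \<open>t\<close> takes negative values.\<close>
  have "b = 0"
  proof (rule ccontr)
    assume "b \<noteq> 0"
    then have "2 * (- (a + 1) / (2 * b)) * b = - (a + 1)" by simp
    then show False
      using nonneg[of "- (a + 1) / (2 * b)"] True by simp
  qed
  then show ?thesis by (simp add: True)
next
  case False
  \<comment> \<open>The minimum is attained at \<open>t = - b / c\<close>.\<close>
  have "a + 2 * (- b / c) * b + (- b / c)\<^sup>2 * c = a - b\<^sup>2 / c"
    using False by (simp add: power2_eq_square)
  then have "b\<^sup>2 / c \<le> a"
    using nonneg[of "- b / c"] by linarith
  then show ?thesis using False assms(2) by (simp add: pos_divide_le_eq)
qed

text \<open>Stated relative to a subspace, because the operator in the eigenvector argument below is positive only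
  on an invariant subspace.\<close>

lemma psd_cauchy_schwarz:
  fixes B :: "'b::real_inner \<Rightarrow> 'b"
  assumes "linear B" and sym: "\<And>v w. B v \<bullet> w = v \<bullet> B w"
    and psd: "\<And>v. v \<in> S \<Longrightarrow> 0 \<le> B v \<bullet> v" and S: "subspace S" "v \<in> S" "w \<in> S"
  shows "(B v \<bullet> w)\<^sup>2 \<le> (B v \<bullet> v) * (B w \<bullet> w)"
proof (rule discriminant_le)
  interpret linear B by fact
  fix t
  have "0 \<le> B (v + t *\<^sub>R w) \<bullet> (v + t *\<^sub>R w)"
    using S by (intro psd subspace_add subspace_scale)
  also have "\<dots> = B v \<bullet> v + 2 * t * (B v \<bullet> w) + t\<^sup>2 * (B w \<bullet> w)"
    using sym[of w v] by (simp add: add scale inner_simps inner_commute power2_eq_square algebra_simps)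
  finally show "0 \<le> B v \<bullet> v + 2 * t * (B v \<bullet> w) + t\<^sup>2 * (B w \<bullet> w)" .
qed (use psd S in auto)

text \<open>Apply Cauchy--Schwarz to the form of \<open>B\<close> at \<open>v\<close> and \<open>B v\<close>.\<close>

lemma psd_norm_le:
  fixes B :: "'b::real_inner \<Rightarrow> 'b"
  assumes "linear B" "\<And>v w. B v \<bullet> w = v \<bullet> B w"
    and psd: "\<And>v. 0 \<le> B v \<bullet> v" and le: "\<And>v. B v \<bullet> v \<le> M * (norm v)\<^sup>2"
  shows psd_norm_le_form: "(norm (B v))\<^sup>2 \<le> M * (B v \<bullet> v)"
    and psd_norm_le_bound: "0 \<le> M \<Longrightarrow> norm (B v) \<le> M * norm v"
proof -
  have cs: "(B v \<bullet> B v)\<^sup>2 \<le> (B v \<bullet> v) * (B (B v) \<bullet> B v)"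
    by (rule psd_cauchy_schwarz[where S = UNIV]) (use assms in auto)
  show *: "(norm (B v))\<^sup>2 \<le> M * (B v \<bullet> v)"
  proof (cases "B v = 0")
    case False
    have "(norm (B v))\<^sup>2 * (norm (B v))\<^sup>2 \<le> (B v \<bullet> v) * (M * (norm (B v))\<^sup>2)"
      using cs mult_left_mono[OF le[of "B v"] psd[of v]]
      by (simp add: power2_norm_eq_inner power2_eq_square[of "B v \<bullet> B v"])
    then have "(norm (B v))\<^sup>2 * (norm (B v))\<^sup>2 \<le> (M * (B v \<bullet> v)) * (norm (B v))\<^sup>2"
      by (simp only: ac_simps)
    then show ?thesis by (rule mult_right_le_imp_le) (use False in simp)
  qed simp
  assume "0 \<le> M"
  have "(norm (B v))\<^sup>2 \<le> M * (M * (norm v)\<^sup>2)"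
    using * mult_left_mono[OF le[of v] \<open>0 \<le> M\<close>] by (rule order_trans)
  also have "\<dots> = (M * norm v)\<^sup>2"
    by (simp add: power_mult_distrib power2_eq_square[of M])
  finally show "norm (B v) \<le> M * norm v"
    by (rule power2_le_imp_le) (use \<open>0 \<le> M\<close> in simp)
qed

text \<open>A unit vector that maximises the Rayleigh quotient over an invariant subspace is an eigenvector: for
  the maximum \<open>l\<close> the form of \<open>l I - B\<close> is positive semidefinite on the subspace and vanishes at the
  maximiser, so by Cauchy--Schwarz the maximiser lies in its kernel.\<close>

lemma selfadjoint_eigenvector:
  fixes B :: "'b::euclidean_space \<Rightarrow> 'b"
  assumes B: "linear B" and sym: "\<And>v w. B v \<bullet> w = v \<bullet> B w"
    and S: "subspace S" "S \<noteq> {0}" and inv: "B ` S \<subseteq> S"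
  obtains e l where "e \<in> S" "norm e = 1" "B e = l *\<^sub>R e"
proof -
  interpret linear B by fact
  obtain s where s: "s \<in> S" "s \<noteq> 0"
    using S subspace_0[OF S(1)] by blast
  have "(1 / norm s) *\<^sub>R s \<in> S \<inter> sphere 0 1"
    using s subspace_scale[OF S(1)] by auto
  then have ne: "S \<inter> sphere 0 1 \<noteq> {}" by blast
  have comp: "compact (S \<inter> sphere 0 1)"
    using closed_subspace[OF S(1)] by (simp add: closed_Int_compact)
  have "continuous_on (S \<inter> sphere 0 1) (\<lambda>x. B x \<bullet> x)"
    by (intro continuous_intros linear_continuous_on linear_conv_bounded_linear[THEN iffD1] B)
  from continuous_attains_sup[OF comp ne this] obtain e where
    e: "e \<in> S" "norm e = 1" and max: "\<And>y. y \<in> S \<Longrightarrow> norm y = 1 \<Longrightarrow> B y \<bullet> y \<le> B e \<bullet> e"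
    by auto
  define l where "l = B e \<bullet> e"
  define D where "D = (\<lambda>x. l *\<^sub>R x - B x)"
  have D: "linear D" unfolding D_def
    by (intro linear_compose_sub linear_scale_self B)
  have symD: "D v \<bullet> w = v \<bullet> D w" for v w
    by (simp add: D_def inner_simps sym)
  have psd: "0 \<le> D y \<bullet> y" if "y \<in> S" for y
  proof (cases "y = 0")
    case False
    let ?y = "(1 / norm y) *\<^sub>R y"
    have "B ?y \<bullet> ?y \<le> l"
      unfolding l_def using that False by (intro max) (auto intro: subspace_scale[OF S(1)])
    then have "B y \<bullet> y \<le> l * (norm y * norm y)"
      using False by (simp add: scale field_simps)
    then show ?thesis
      by (simp add: D_def inner_simps power2_norm_eq_inner[symmetric] power2_eq_square)
  qed simp
  have De: "D e \<in> S"
    unfolding D_def using e inv by (intro subspace_diff subspace_scale S) auto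
  have "e \<bullet> e = 1" using e by (simp add: norm_eq_1)
  then have "D e \<bullet> e = 0"
    by (simp add: D_def l_def inner_simps)
  with psd_cauchy_schwarz[OF D symD psd S(1) e(1) De] have "D e = 0"
    by simp
  then have "B e = l *\<^sub>R e" by (simp add: D_def)
  with e that show thesis by blast
qed

text \<open>Split off an eigenvector and continue in its orthogonal complement, which is again invariant.\<close>

lemma selfadjoint_eigenbasis:
  fixes B :: "'b::euclidean_space \<Rightarrow> 'b"
  assumes B: "linear B" and sym: "\<And>v w. B v \<bullet> w = v \<bullet> B w"
    and "subspace S" "B ` S \<subseteq> S"
  shows "\<exists>E l. finite E \<and> E \<subseteq> S \<and> (\<forall>b\<in>E. \<forall>c\<in>E. b \<bullet> c = (if b = c then 1 else 0)) \<and>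
           (\<forall>b\<in>E. B b = l b *\<^sub>R b) \<and> (\<forall>x\<in>S. x = (\<Sum>b\<in>E. (x \<bullet> b) *\<^sub>R b))"
  using assms(3,4)
proof (induction "dim S" arbitrary: S rule: less_induct)
  case less
  show ?case
  proof (cases "S = {0}")
    case True
    then show ?thesis by (intro exI[of _ "{}"]) auto
  next
    case False
    obtain e k where e: "e \<in> S" "norm e = 1" and k: "B e = k *\<^sub>R e"
      by (rule selfadjoint_eigenvector[OF B sym less.prems(1) False less.prems(2)])
    have ee: "e \<bullet> e = 1" using e by (simp add: norm_eq_1)
    define S' where "S' = {x \<in> S. x \<bullet> e = 0}"
    have S': "subspace S'"
      using less.prems(1) unfolding S'_def subspace_def by (auto simp: inner_simps)
    have inv: "B ` S' \<subseteq> S'"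
      using less.prems(2) by (auto simp: S'_def sym k)
    have "S' \<subset> S" using e ee unfolding S'_def by force
    then have "dim S' < dim S"
      by (metis S' less.prems(1) dim_psubset span_eq_iff)
    from less.hyps[OF this S' inv] obtain E l where
      E: "finite E" "E \<subseteq> S'" and on: "\<forall>b\<in>E. \<forall>c\<in>E. b \<bullet> c = (if b = c then 1 else 0)"
        and eig: "\<forall>b\<in>E. B b = l b *\<^sub>R b" and rep': "\<forall>x\<in>S'. x = (\<Sum>b\<in>E. (x \<bullet> b) *\<^sub>R b)"
      by (elim exE conjE) (rule that)
    have perp: "b \<bullet> e = 0" "e \<bullet> b = 0" if "b \<in> E" for b
      using E(2) that by (auto simp: S'_def inner_commute)
    have eE: "e \<notin> E" using perp ee by force
    have rep: "x = (\<Sum>b\<in>insert e E. (x \<bullet> b) *\<^sub>R b)" if "x \<in> S" for x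
    proof -
      have "x - (x \<bullet> e) *\<^sub>R e \<in> S'"
        using that e less.prems(1) ee
        by (auto simp: S'_def inner_simps intro: subspace_diff subspace_scale)
      from bspec[OF rep' this] have "x - (x \<bullet> e) *\<^sub>R e = (\<Sum>b\<in>E. (x \<bullet> b) *\<^sub>R b)"
        by (simp add: inner_simps perp cong: sum.cong)
      then show ?thesis using eE E(1) by (simp add: algebra_simps)
    qed
    show ?thesis
    proof (intro exI conjI ballI)
      show "insert e E \<subseteq> S" using e E(2) by (auto simp: S'_def)
      show "B b = (l(e := k)) b *\<^sub>R b" if "b \<in> insert e E" for b
        using that k eig eE by auto
      show "b \<bullet> c = (if b = c then 1 else 0)" if "b \<in> insert e E" "c \<in> insert e E" for b c
        using that on perp ee eE by auto
    qed (use E(1) rep in auto)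
  qed
qed

text \<open>Take the square roots of the eigenvalues in an orthonormal eigenbasis.\<close>

lemma psd_square_root_exists:
  fixes B :: "'b::euclidean_space \<Rightarrow> 'b"
  assumes B: "linear B" and sym: "\<And>v w. B v \<bullet> w = v \<bullet> B w" and psd: "\<And>v. 0 \<le> B v \<bullet> v"
  shows "\<exists>R. linear R \<and> (\<forall>v w. R v \<bullet> w = v \<bullet> R w) \<and> (\<forall>v. 0 \<le> R v \<bullet> v) \<and> (\<forall>v. R (R v) = B v)"
proof -
  obtain E l where E: "finite E"
    and on': "\<forall>b\<in>E. \<forall>c\<in>E. b \<bullet> c = (if b = c then 1 else 0)"
    and eig': "\<forall>b\<in>E. B b = l b *\<^sub>R b" and rep: "\<forall>x\<in>UNIV. x = (\<Sum>b\<in>E. (x \<bullet> b) *\<^sub>R b)"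
    using selfadjoint_eigenbasis[OF B sym subspace_UNIV subset_UNIV] by (elim exE conjE) (rule that)
  note on = bspec[OF bspec[OF on']] and eig = bspec[OF eig']
  have l: "0 \<le> l b" if "b \<in> E" for b
    using psd[of b] eig[OF that] on[OF that that] by simp
  define R where "R v = (\<Sum>b\<in>E. (sqrt (l b) * (v \<bullet> b)) *\<^sub>R b)" for v
  have Rb: "R v \<bullet> c = sqrt (l c) * (v \<bullet> c)" if "c \<in> E" for v c
  proof -
    have "R v \<bullet> c = (\<Sum>b\<in>E. if b = c then sqrt (l b) * (v \<bullet> b) else 0)"
      unfolding R_def inner_sum_left by (rule sum.cong) (auto simp: on that)
    then show ?thesis using that E by simp
  qed
  have "linear R"
    by (rule linearI) (auto simp: R_def inner_simps algebra_simps sum.distrib scaleR_sum_right)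
  moreover have "R v \<bullet> w = v \<bullet> R w" for v w
    by (simp add: R_def inner_sum_left inner_sum_right inner_commute algebra_simps)
  moreover have "0 \<le> R v \<bullet> v" for v
    unfolding R_def inner_sum_left
    by (rule sum_nonneg) (use l in \<open>auto simp: inner_commute[of _ v] mult.assoc\<close>)
  moreover have "R (R v) = B v" for v
  proof -
    have "R (R v) = (\<Sum>b\<in>E. (v \<bullet> b) *\<^sub>R B b)"
      unfolding R_def[of "R v"] by (rule sum.cong) (use l in \<open>auto simp: Rb eig\<close>)
    also have "\<dots> = B (\<Sum>b\<in>E. (v \<bullet> b) *\<^sub>R b)"
      using B by (simp add: linear_sum linear_scale)
    finally show ?thesis using bspec[OF rep, of v] by simp
  qed
  ultimately show ?thesis by blast
qed

text \<open>Every symmetric square root \<open>R\<close> satisfies \<open>R v \<bullet> R v = R (R v) \<bullet> v\<close>, whichever root is selected.\<close>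

lemma inner_op_sqrt:
  fixes B :: "'b::euclidean_space \<Rightarrow> 'b"
  assumes "linear B" "\<And>v w. B v \<bullet> w = v \<bullet> B w" "\<And>v. 0 \<le> B v \<bullet> v"
  shows "op_sqrt B v \<bullet> op_sqrt B v = B v \<bullet> v"
proof -
  have "linear (op_sqrt B) \<and> (\<forall>M N. op_sqrt B M \<bullet> N = M \<bullet> op_sqrt B N) \<and>
      (\<forall>M. 0 \<le> op_sqrt B M \<bullet> M) \<and> (\<forall>M. op_sqrt B (op_sqrt B M) = B M)"
    unfolding op_sqrt_def using psd_square_root_exists[OF assms] by (rule someI_ex)
  then show ?thesis by (metis inner_commute)
qed

section \<open>Continuously differentiable functions\<close>

lemma continuous_measurable_lebesgue_on:
  fixes f :: "'a::euclidean_space \<Rightarrow> 'b::euclidean_space"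
  assumes "continuous_on UNIV f"
  shows "f \<in> borel_measurable (lebesgue_on \<Omega>)"
proof -
  have "f \<in> borel_measurable lborel"
    using borel_measurable_continuous_onI[OF assms] by simp
  then show ?thesis
    by (intro measurable_restrict_space1 measurable_completion)
qed

lemma L2_const:
  assumes "open \<Omega>" "bounded \<Omega>"
  shows "(\<lambda>x. v) \<in> L2 \<Omega>"
proof -
  interpret finite_measure "lebesgue_on \<Omega>"
    using assms by (intro finite_measure_lebesgue_on lmeasurable_open)
  show ?thesis by (simp add: L2_def)
qed

lemma L2_continuous:
  fixes f :: "real ^ 'n \<Rightarrow> 'b::euclidean_space"
  assumes "open \<Omega>" "bounded \<Omega>" "continuous_on UNIV f"
  shows "f \<in> L2 \<Omega>"
proof -
  have "compact (f ` closure \<Omega>)"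
    using assms by (intro compact_continuous_image) (auto intro: continuous_on_subset)
  then obtain B where "\<And>x. x \<in> closure \<Omega> \<Longrightarrow> norm (f x) \<le> B"
    by (meson bounded_iff compact_imp_bounded imageI)
  then have "\<And>x. x \<in> \<Omega> \<Longrightarrow> norm (f x) \<le> B"
    using closure_subset by blast
  then show ?thesis
    by (intro L2_dominated[OF L2_const[OF assms(1,2), of "1::real"], where B = B] AE_I2
        continuous_measurable_lebesgue_on assms(3)) auto
qed

lemma C1_continuous:
  assumes "C1_with_grad \<phi> g"
  shows C1_continuous_fun: "continuous_on UNIV \<phi>" and C1_continuous_grad: "continuous_on UNIV g"
  using assms by (auto simp: C1_with_grad_def intro: has_derivative_continuous continuous_at_imp_continuous_on)

lemma C1_const: "C1_with_grad (\<lambda>x. c) (\<lambda>x. 0)"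
  by (simp add: C1_with_grad_def)

lemma C1_mult:
  assumes "C1_with_grad \<phi> g" "C1_with_grad \<psi> h"
  shows "C1_with_grad (\<lambda>x. \<phi> x * \<psi> x) (\<lambda>x. \<phi> x *\<^sub>R h x + \<psi> x *\<^sub>R g x)"
  unfolding C1_with_grad_def
proof (intro conjI allI)
  fix x
  have "((\<lambda>x. \<phi> x * \<psi> x) has_derivative (\<lambda>k. \<phi> x * (h x \<bullet> k) + (g x \<bullet> k) * \<psi> x)) (at x)"
    using assms by (intro has_derivative_mult) (auto simp: C1_with_grad_def)
  then show "((\<lambda>x. \<phi> x * \<psi> x) has_derivative (\<lambda>k. (\<phi> x *\<^sub>R h x + \<psi> x *\<^sub>R g x) \<bullet> k)) (at x)"
    by (simp add: inner_simps mult.commute)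
qed (intro continuous_intros C1_continuous[OF assms(1)] C1_continuous[OF assms(2)])

lemma C1_compose:
  assumes \<phi>: "C1_with_grad \<phi> g"
    and F: "\<And>t. (F has_real_derivative F' t) (at t)" "continuous_on UNIV F'"
  shows "C1_with_grad (\<lambda>x. F (\<phi> x)) (\<lambda>x. F' (\<phi> x) *\<^sub>R g x)"
  unfolding C1_with_grad_def
proof (intro conjI allI)
  fix x
  have "((\<lambda>x. F (\<phi> x)) has_derivative (\<lambda>k. (g x \<bullet> k) * F' (\<phi> x))) (at x)"
    using \<phi> by (intro DERIV_compose_FDERIV F) (auto simp: C1_with_grad_def)
  then show "((\<lambda>x. F (\<phi> x)) has_derivative (\<lambda>k. (F' (\<phi> x) *\<^sub>R g x) \<bullet> k)) (at x)"
    by (simp add: mult.commute)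
next
  show "continuous_on UNIV (\<lambda>x. F' (\<phi> x) *\<^sub>R g x)"
    by (intro continuous_intros C1_continuous[OF \<phi>] continuous_on_compose2[OF F(2) C1_continuous_fun[OF \<phi>]]) auto
qed

lemma C1_prod:
  assumes "finite I" "\<And>i. i \<in> I \<Longrightarrow> \<exists>g. C1_with_grad (\<phi> i) g"
  shows "\<exists>g. C1_with_grad (\<lambda>x. \<Prod>i\<in>I. \<phi> i x) g"
  using assms
proof (induction I rule: finite_induct)
  case empty
  then show ?case using C1_const by auto
next
  case (insert j I)
  then have "\<exists>g. C1_with_grad (\<phi> j) g" "\<exists>h. C1_with_grad (\<lambda>x. \<Prod>i\<in>I. \<phi> i x) h"
    by auto
  then obtain g h where "C1_with_grad (\<phi> j) g" "C1_with_grad (\<lambda>x. \<Prod>i\<in>I. \<phi> i x) h"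
    by blast
  from C1_mult[OF this] insert.hyps show ?case by auto
qed

text \<open>The square makes the positive part continuously differentiable. The function is positive exactly on
  an open half-space, and products of such functions single out boxes.\<close>

lemma C1_halfspace_bump:
  "C1_with_grad (\<lambda>x. (max 0 (w \<bullet> x - c))\<^sup>2) (\<lambda>x. (2 * max 0 (w \<bullet> x - c)) *\<^sub>R w)"
proof (rule C1_compose[where F = "\<lambda>t. (max 0 (t - c))\<^sup>2" and \<phi> = "\<lambda>x. w \<bullet> x"])
  show "C1_with_grad (\<lambda>x. w \<bullet> x) (\<lambda>x. w)"
    by (auto simp: C1_with_grad_def intro!: derivative_eq_intros)
  show "continuous_on UNIV (\<lambda>t. 2 * max 0 (t - c))"
    by (intro continuous_intros)
  fix t
  consider "t < c" | "t = c" | "t > c" by linarith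
  then show "((\<lambda>t. (max 0 (t - c))\<^sup>2) has_real_derivative 2 * max 0 (t - c)) (at t)"
  proof cases
    case 1
    have "((\<lambda>t. 0) has_real_derivative 2 * max 0 (t - c)) (at t)"
      using 1 by simp
    then show ?thesis
      by (rule has_field_derivative_transform_within_open[where S = "{..<c}"]) (use 1 in auto)
  next
    case 2
    have "(\<lambda>h. ((max 0 (t + h - c))\<^sup>2 - (max 0 (t - c))\<^sup>2) / h) \<midarrow>0\<rightarrow> 0"
    proof (rule Lim_null_comparison)
      show "\<forall>\<^sub>F h in at 0. norm (((max 0 (t + h - c))\<^sup>2 - (max 0 (t - c))\<^sup>2) / h) \<le> \<bar>h\<bar>"
        using 2 by (auto intro!: always_eventually simp: max_def power2_eq_square)
      show "((\<lambda>h::real. \<bar>h\<bar>) \<longlongrightarrow> 0) (at 0)"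
        by (auto intro!: tendsto_eq_intros)
    qed
    then show ?thesis using 2 by (simp add: DERIV_def)
  next
    case 3
    have "((\<lambda>t. (t - c)\<^sup>2) has_real_derivative 2 * max 0 (t - c)) (at t)"
      using 3 by (auto intro!: derivative_eq_intros)
    then show ?thesis
      by (rule has_field_derivative_transform_within_open[where S = "{c<..}"]) (use 3 in auto)
  qed
qed

abbreviation test_function :: "(real ^ 'n) set \<Rightarrow> (real ^ 'n \<Rightarrow> real) \<Rightarrow> (real ^ 'n \<Rightarrow> real ^ 'n) \<Rightarrow> bool" where
  "test_function \<Omega> \<phi> g \<equiv>
     C1_with_grad \<phi> g \<and> compact (closure {x. \<phi> x \<noteq> 0}) \<and> closure {x. \<phi> x \<noteq> 0} \<subseteq> \<Omega>"

lemma test_function_mult: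
  assumes "test_function \<Omega> \<phi> g" "C1_with_grad \<psi> h"
  shows "test_function \<Omega> (\<lambda>x. \<phi> x * \<psi> x) (\<lambda>x. \<phi> x *\<^sub>R h x + \<psi> x *\<^sub>R g x)"
proof -
  have *: "closure {x. \<phi> x * \<psi> x \<noteq> 0} \<subseteq> closure {x. \<phi> x \<noteq> 0}"
    by (rule closure_mono) auto
  have "bounded {x. \<phi> x * \<psi> x \<noteq> 0}"
    by (rule bounded_subset[of "{x. \<phi> x \<noteq> 0}"]) (use assms(1) in auto)
  then have "compact (closure {x. \<phi> x * \<psi> x \<noteq> 0})"
    by (simp add: compact_closure)
  moreover have "closure {x. \<phi> x * \<psi> x \<noteq> 0} \<subseteq> \<Omega>"
    using * assms(1) by (elim conjE) (rule order_trans)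
  ultimately show ?thesis
    using assms by (intro conjI C1_mult) auto
qed

text \<open>If \<open>P\<close> is a nonnegative \<open>C\<^sup>1\<close> function that is positive exactly on the open box, the functions
  \<open>1 - exp (- k P)\<close> are test functions with values in \<open>[0, 1]\<close> and tend to the indicator of the box. Such a
  \<open>P\<close> is a product over the coordinates of half-space functions for the two faces.\<close>

lemma test_functions_tend_to_box:
  fixes a b :: "real ^ 'n"
  assumes "cbox a b \<subseteq> \<Omega>"
  shows "\<exists>\<phi>. (\<forall>k::nat. \<exists>g. test_function \<Omega> (\<phi> k) g) \<and> (\<forall>k x. 0 \<le> \<phi> k x \<and> \<phi> k x \<le> 1) \<and>
           (\<forall>x. (\<lambda>k. \<phi> k x) \<longlonglongrightarrow> indicator (box a b) x)"
proof -
  define P :: "real ^ 'n \<Rightarrow> real" where "P x = (\<Prod>i\<in>UNIV. (max 0 (x $ i - a $ i))\<^sup>2 * (max 0 (b $ i - x $ i))\<^sup>2)" for x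
  have "\<exists>g. C1_with_grad P g"
    unfolding P_def
  proof (rule C1_prod)
    fix i :: 'n
    show "\<exists>g. C1_with_grad (\<lambda>x. (max 0 (x $ i - a $ i))\<^sup>2 * (max 0 (b $ i - x $ i))\<^sup>2) g"
      using C1_mult[OF C1_halfspace_bump[of "axis i 1" "a $ i"] C1_halfspace_bump[of "- axis i 1" "- b $ i"]]
      by (auto simp: inner_axis')
  qed simp
  then obtain g where g: "C1_with_grad P g" ..
  have P0: "0 \<le> P x" for x
    by (simp add: P_def prod_nonneg)
  have Ppos: "P x \<noteq> 0 \<longleftrightarrow> x \<in> box a b" for x
  proof -
    have "(max 0 (x $ i - a $ i))\<^sup>2 * (max 0 (b $ i - x $ i))\<^sup>2 \<noteq> 0 \<longleftrightarrow> a $ i < x $ i \<and> x $ i < b $ i" for i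
      by (simp add: max_def) linarith
    then show ?thesis by (simp add: P_def mem_box_cart del: mult_eq_0_iff)
  qed
  define \<phi> where "\<phi> k x = 1 - exp (- (real k * P x))" for k x
  have supp: "closure {x. \<phi> k x \<noteq> 0} \<subseteq> cbox a b" for k
    by (rule closure_minimal) (use Ppos in \<open>auto simp: \<phi>_def intro: box_subset_cbox[THEN subsetD]\<close>)
  show ?thesis
  proof (rule exI[of _ \<phi>], intro conjI allI)
    show "\<exists>g. test_function \<Omega> (\<phi> k) g" for k
    proof (intro exI conjI)
      show "C1_with_grad (\<phi> k) (\<lambda>x. (real k * exp (- (real k * P x))) *\<^sub>R g x)"
        unfolding \<phi>_def[abs_def]
        by (rule C1_compose[OF g, where F = "\<lambda>t. 1 - exp (- (real k * t))"])
           (auto intro!: derivative_eq_intros continuous_intros)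
      show "compact (closure {x. \<phi> k x \<noteq> 0})"
        unfolding compact_eq_bounded_closed using bounded_subset[OF bounded_cbox supp[of k]] by simp
      show "closure {x. \<phi> k x \<noteq> 0} \<subseteq> \<Omega>"
        using supp assms by blast
    qed
    show "0 \<le> \<phi> k x" "\<phi> k x \<le> 1" for k x
      using P0[of x] by (auto simp: \<phi>_def)
    show "(\<lambda>k. \<phi> k x) \<longlonglongrightarrow> indicator (box a b) x" for x
    proof (cases "x \<in> box a b")
      case True
      then have "exp (- P x) < 1" using Ppos[of x] P0[of x] by simp
      then have "(\<lambda>k. 1 - exp (- P x) ^ k) \<longlonglongrightarrow> 1 - 0"
        by (intro tendsto_intros LIMSEQ_realpow_zero) auto
      moreover have "\<phi> k x = 1 - exp (- P x) ^ k" for k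
        using exp_of_nat_mult[of k "- P x"] by (simp add: \<phi>_def)
      ultimately show ?thesis using True by simp
    next
      case False
      then have "\<phi> k x = 0" for k using Ppos[of x] by (simp add: \<phi>_def)
      then show ?thesis using False by simp
    qed
  qed
qed

text \<open>Testing with squares of test functions that tend to the indicator of a box shows that \<open>f\<close> has a
  nonnegative integral over each box in \<open>\<Omega>\<close>; the claim then follows by Lebesgue differentiation.\<close>

lemma AE_nonneg_if_test_squares_nonneg:
  fixes f :: "real ^ 'n \<Rightarrow> real"
  assumes \<Omega>: "open \<Omega>" and f: "integrable (lebesgue_on \<Omega>) f"
    and nonneg: "\<And>\<phi> g. test_function \<Omega> \<phi> g \<Longrightarrow> 0 \<le> (LINT x|lebesgue_on \<Omega>. (\<phi> x)\<^sup>2 * f x)"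
  shows "AE x in lebesgue_on \<Omega>. 0 \<le> f x"
proof -
  have sets: "\<Omega> \<in> sets lebesgue" using \<Omega> by (simp add: borel_open)
  define F where "F = (\<lambda>x. if x \<in> \<Omega> then f x else 0)"
  have F: "integrable lebesgue F"
    unfolding F_def using Lebesgue_Measure.integrable_restrict_UNIV[OF sets, of f] f by blast
  have F_on: "F integrable_on cbox a b" for a b
    using has_integral_integral_lebesgue[OF F] integrable_on_subcbox by blast
  have box: "0 \<le> integral (cbox a b) F" if ab: "cbox a b \<subseteq> \<Omega>" for a b
  proof -
    obtain \<phi> where \<phi>: "\<forall>k::nat. \<exists>g. test_function \<Omega> (\<phi> k) g"
      and bd: "\<forall>k x. 0 \<le> \<phi> k x \<and> \<phi> k x \<le> 1"
      and lim: "\<forall>x. (\<lambda>k. \<phi> k x) \<longlonglongrightarrow> indicator (box a b) x"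
      using test_functions_tend_to_box[OF ab] by (elim exE conjE) (rule that)
    have [measurable]: "\<phi> k \<in> borel_measurable (lebesgue_on \<Omega>)" for k
      using \<phi> C1_continuous_fun continuous_measurable_lebesgue_on by blast
    have [measurable]: "f \<in> borel_measurable (lebesgue_on \<Omega>)"
      using f by auto
    have bsets: "box a b \<in> sets lebesgue" by simp
    have [measurable]: "box a b \<inter> \<Omega> \<in> sets (lebesgue_on \<Omega>)"
      using sets.Int[OF bsets sets] sets by (simp add: sets_restrict_space_iff)
    have "(\<lambda>k. LINT x|lebesgue_on \<Omega>. (\<phi> k x)\<^sup>2 * f x) \<longlonglongrightarrow>
        (LINT x|lebesgue_on \<Omega>. (indicator (box a b) x)\<^sup>2 * f x)"
    proof (rule integral_dominated_convergence)
      show "integrable (lebesgue_on \<Omega>) (\<lambda>x. norm (f x))"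
        using f by simp
      show "AE x in lebesgue_on \<Omega>. (\<lambda>k. (\<phi> k x)\<^sup>2 * f x) \<longlonglongrightarrow> (indicator (box a b) x)\<^sup>2 * f x"
        by (intro AE_I2 tendsto_intros lim[rule_format])
      show "AE x in lebesgue_on \<Omega>. norm ((\<phi> k x)\<^sup>2 * f x) \<le> norm (f x)" for k
        using bd by (intro AE_I2) (auto simp: abs_mult power_le_one mult_left_le_one_le)
      show "(\<lambda>x. (indicator (box a b) x)\<^sup>2 * f x) \<in> borel_measurable (lebesgue_on \<Omega>)"
      proof -
        have "(\<lambda>x. indicator (box a b \<inter> \<Omega>) x * f x) \<in> borel_measurable (lebesgue_on \<Omega>)"
          by measurable
        then show ?thesis
          by (rule measurable_cong[THEN iffD1, rotated]) (auto simp: indicator_def)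
      qed
    qed measurable
    then have "0 \<le> (LINT x|lebesgue_on \<Omega>. (indicator (box a b) x)\<^sup>2 * f x)"
      by (rule LIMSEQ_le_const) (use \<phi> nonneg in blast)
    also have "\<dots> = (LINT x|lebesgue. (if x \<in> box a b then F x else 0))"
      unfolding Lebesgue_Measure.integral_restrict_UNIV[OF sets, symmetric]
      by (rule Bochner_Integration.integral_cong) (auto simp: F_def)
    also have "\<dots> = (LINT x|lebesgue_on (box a b). F x)"
      by (rule Lebesgue_Measure.integral_restrict_UNIV[OF bsets])
    also have "\<dots> = integral (box a b) F"
    proof (rule lebesgue_integral_eq_integral[OF _ bsets])
      show "integrable (lebesgue_on (box a b)) F"
        using integrable_mult_indicator[OF bsets F] bsets
        by (intro integrable_restrict_space[THEN iffD2]) auto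
    qed
    also have "\<dots> = integral (cbox a b) F"
      by (rule integral_open_interval)
    finally show ?thesis .
  qed
  obtain N where N: "negligible N" and
    diff: "\<And>x e. \<lbrakk>x \<notin> N; 0 < e\<rbrakk> \<Longrightarrow> \<exists>d>0. \<forall>h. 0 < h \<and> h < d \<longrightarrow>
      norm (integral (cbox x (x + h *\<^sub>R One)) F /\<^sub>R h ^ DIM(real ^ 'n) - F x) < e"
    using integrable_ccontinuous_explicit[OF F_on] by blast
  have "0 \<le> f x" if x: "x \<in> \<Omega>" "x \<notin> N" for x
  proof (rule ccontr)
    assume "\<not> 0 \<le> f x"
    then have neg: "F x < 0" using x by (simp add: F_def)
    obtain r where r: "0 < r" "ball x r \<subseteq> \<Omega>"
      using \<Omega> x(1) open_contains_ball by blast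
    obtain d where d: "0 < d" and near: "\<And>h. 0 < h \<Longrightarrow> h < d \<Longrightarrow>
        norm (integral (cbox x (x + h *\<^sub>R One)) F /\<^sub>R h ^ DIM(real ^ 'n) - F x) < - F x"
      using diff[OF x(2), of "- F x"] neg by auto
    define s where "s = norm (One :: real ^ 'n)"
    have "0 \<le> s" by (simp add: s_def)
    \<comment> \<open>A cube of side \<open>h\<close> at \<open>x\<close> has diameter \<open>h s\<close>, hence lies in the ball of radius \<open>r\<close>.\<close>
    define h where "h = min (d / 2) (r / (2 * (s + 1)))"
    have "0 < h" "h < d" using d r \<open>0 \<le> s\<close> by (auto simp: h_def)
    have "h * s < r"
    proof -
      have "h * s \<le> (r / (2 * (s + 1))) * (s + 1)"
        using r \<open>0 \<le> s\<close> \<open>0 < h\<close> by (intro mult_mono) (auto simp: h_def)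
      also have "\<dots> = r / 2" using \<open>0 \<le> s\<close> by (simp add: field_simps)
      also have "\<dots> < r" using r by simp
      finally show ?thesis .
    qed
    have "cbox x (x + h *\<^sub>R One) \<subseteq> \<Omega>"
    proof
      fix y assume y: "y \<in> cbox x (x + h *\<^sub>R One)"
      have "norm (y - x) \<le> norm (h *\<^sub>R One :: real ^ 'n)"
        using y \<open>0 < h\<close> by (intro norm_le_componentwise) (auto simp: mem_box inner_simps)
      also have "\<dots> < r" using \<open>h * s < r\<close> \<open>0 < h\<close> by (simp add: s_def)
      finally show "y \<in> \<Omega>" using r by (auto simp: dist_norm norm_minus_commute)
    qed
    from box[OF this] \<open>0 < h\<close> have "0 \<le> integral (cbox x (x + h *\<^sub>R One)) F /\<^sub>R h ^ DIM(real ^ 'n)"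
      by simp
    with near[OF \<open>0 < h\<close> \<open>h < d\<close>] neg show False by simp
  qed
  then have "AE x in lebesgue. x \<in> \<Omega> \<longrightarrow> 0 \<le> f x"
    using N by (intro AE_I'[of N]) (auto simp: negligible_iff_null_sets)
  then show ?thesis
    using sets by (subst AE_restrict_space_iff) auto
qed

section \<open>Compactly supported fields and the weak divergence\<close>

lemma gradient_zero_off_support:
  assumes "C1_with_grad \<eta> g" "x \<notin> closure {x. \<eta> x \<noteq> 0}"
  shows "g x = 0"
proof -
  have "(\<eta> has_derivative (\<lambda>h. 0)) (at x)"
    by (rule has_derivative_transform_within_open[OF has_derivative_const[of 0],
          where s = "- closure {x. \<eta> x \<noteq> 0}"])
      (use assms(2) closure_subset[of "{x. \<eta> x \<noteq> 0}"] in auto)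
  moreover have "(\<eta> has_derivative (\<lambda>h. g x \<bullet> h)) (at x)"
    using assms(1) by (simp add: C1_with_grad_def)
  ultimately have "(\<lambda>h. g x \<bullet> h) = (\<lambda>h. 0)"
    using has_derivative_unique by blast
  then show ?thesis by (metis inner_eq_zero_iff)
qed

text \<open>By translation invariance the difference quotients in direction \<open>v\<close> have integral zero; they converge
  dominatedly to the directional derivative.\<close>

lemma integral_directional_derivative_zero:
  assumes \<eta>: "C1_with_grad \<eta> g" and compact: "compact (closure {x. \<eta> x \<noteq> 0})"
  shows "(LINT x|lborel. g x \<bullet> v) = 0"
proof -
  obtain R where R: "\<And>x. x \<in> closure {x. \<eta> x \<noteq> 0} \<Longrightarrow> norm x \<le> R"
    using compact_imp_bounded[OF compact] by (auto simp: bounded_iff)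
  have zero: "\<eta> x = 0" if "R < norm x" for x
    using R[of x] that closure_subset[of "{x. \<eta> x \<noteq> 0}"] by auto
  have "compact (g ` cball 0 (R + 2 * norm v))"
    by (intro compact_continuous_image continuous_on_subset[OF C1_continuous_grad[OF \<eta>]]) auto
  then obtain G where G: "\<And>x. norm x \<le> R + 2 * norm v \<Longrightarrow> norm (g x) \<le> G"
    using compact_imp_bounded by (force simp: bounded_iff)
  have [measurable]: "\<eta> \<in> borel_measurable borel" "g \<in> borel_measurable borel"
    using C1_continuous[OF \<eta>] by (auto intro: borel_measurable_continuous_onI)
  have int: "integrable lborel \<eta>"
  proof -
    have "integrable lborel (\<lambda>x. indicator (cball 0 R) x *\<^sub>R \<eta> x)"
      by (intro borel_integrable_compact continuous_on_subset[OF C1_continuous_fun[OF \<eta>]]) auto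
    also have "(\<lambda>x. indicator (cball 0 R) x *\<^sub>R \<eta> x) = \<eta>"
      using zero by (auto simp: indicator_def fun_eq_iff)
    finally show ?thesis .
  qed
  define t where "t k = 1 / real (Suc k)" for k
  have t: "0 < t k" "t k \<le> 1" for k by (auto simp: t_def)
  define q where "q k x = (\<eta> (t k *\<^sub>R v + x) - \<eta> x) / t k" for k x
  have int0: "(LINT x|lborel. q k x) = 0" for k
  proof -
    have shift: "integrable lborel (\<lambda>x. \<eta> (t k *\<^sub>R v + x))"
      "(LINT x|lborel. \<eta> (t k *\<^sub>R v + x)) = (LINT x|lborel. \<eta> x)"
      using integrable_distr_eq[of "(+) (t k *\<^sub>R v)" lborel borel \<eta>] int
        integral_distr[of "(+) (t k *\<^sub>R v)" lborel borel \<eta>]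
      by (auto simp: lborel_distr_plus)
    then show ?thesis using int by (simp add: q_def)
  qed
  have lim: "(\<lambda>k. q k x) \<longlonglongrightarrow> g x \<bullet> v" for x
  proof -
    have "((\<lambda>s. \<eta> (x + s *\<^sub>R v)) has_derivative (\<lambda>s. g x \<bullet> (s *\<^sub>R v))) (at 0)"
      by (rule has_derivative_compose[where g = \<eta> and f = "\<lambda>s. x + s *\<^sub>R v"])
         (use \<eta> in \<open>auto simp: C1_with_grad_def intro!: derivative_eq_intros\<close>)
    then have "((\<lambda>s. \<eta> (x + s *\<^sub>R v)) has_real_derivative (g x \<bullet> v)) (at 0)"
      by (simp add: has_field_derivative_def mult.commute[of _ "g x \<bullet> v"])
    then have "((\<lambda>s. (\<eta> (x + s *\<^sub>R v) - \<eta> x) / s) \<longlongrightarrow> g x \<bullet> v) (at 0)"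
      by (simp add: DERIV_def)
    moreover have "filterlim t (at 0) sequentially"
      unfolding filterlim_at t_def using LIMSEQ_inverse_real_of_nat
      by (auto simp: inverse_eq_divide)
    ultimately show ?thesis
      unfolding q_def add.commute[of _ x] by (rule filterlim_compose)
  qed
  have bound: "norm (q k x) \<le> indicator (cball 0 (R + norm v)) x *\<^sub>R (G * norm v)" for k x
  proof (cases "norm x \<le> R + norm v")
    case True
    have "norm (\<eta> (t k *\<^sub>R v + x) - \<eta> x) \<le> G * norm (t k *\<^sub>R v + x - x)"
    proof (rule differentiable_bound[where S = "cball x (norm v)" and f' = "\<lambda>x h. g x \<bullet> h"])
      show "onorm (\<lambda>h. g y \<bullet> h) \<le> G" if "y \<in> cball x (norm v)" for y
      proof (rule onorm_le)
        fix h
        have "norm y \<le> norm x + norm v"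
          using that norm_triangle_ineq2[of y x] by (simp add: dist_norm norm_minus_commute)
        then have "norm (g y) \<le> G" using True by (intro G) simp
        then show "norm (g y \<bullet> h) \<le> G * norm h"
          using Cauchy_Schwarz_ineq2[of "g y" h] mult_right_mono[of "norm (g y)" G "norm h"]
          by simp
      qed
      show "t k *\<^sub>R v + x \<in> cball x (norm v)"
        using t[of k] by (simp add: dist_norm mult_left_le_one_le)
    qed (use \<eta> in \<open>auto simp: C1_with_grad_def intro: has_derivative_at_withinI\<close>)
    then show ?thesis using True t[of k] by (simp add: q_def divide_simps mult_ac)
  next
    case False
    have "t k * norm v \<le> norm v" using t[of k] by (simp add: mult_left_le_one_le)
    then have "R < norm (t k *\<^sub>R v + x)"
      using False t[of k] norm_diff_ineq[of x "t k *\<^sub>R v"] by (simp add: add.commute)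
    moreover have "R < norm x" using False by (smt (verit) norm_ge_zero)
    ultimately show ?thesis using False by (simp add: q_def zero)
  qed
  have "(\<lambda>k. LINT x|lborel. q k x) \<longlonglongrightarrow> (LINT x|lborel. g x \<bullet> v)"
  proof (rule integral_dominated_convergence)
    show "integrable lborel (\<lambda>x. indicator (cball 0 (R + norm v)) x *\<^sub>R (G * norm v))"
      by (intro borel_integrable_compact) auto
    show "AE x in lborel. norm (q k x) \<le> indicator (cball 0 (R + norm v)) x *\<^sub>R (G * norm v)" for k
      using bound by simp
    show "q k \<in> borel_measurable lborel" for k
      unfolding q_def[abs_def] by measurable
  qed (use lim in \<open>auto intro: AE_I2\<close>)
  then show ?thesis
    by (simp add: int0 LIMSEQ_const_iff)
qed

text \<open>The product of the two scalar functions has compact support in \<open>\<Omega>\<close>, so its derivative in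
  direction \<open>v\<close> has integral zero. As \<open>\<psi>\<close> ranges over all \<open>C\<^sup>1\<close>
  functions, this covers the test functions of the normal trace as well as those of the weak divergence.\<close>

lemma green_compactly_supported:
  assumes \<Omega>: "open \<Omega>" "bounded \<Omega>" and \<phi>: "test_function \<Omega> \<phi> g" and \<psi>: "C1_with_grad \<psi> h"
  shows "ip \<Omega> (\<lambda>x. \<phi> x *\<^sub>R v) h = - ip \<Omega> (\<lambda>x. g x \<bullet> v) \<psi>"
proof -
  have sets: "\<Omega> \<in> sets lebesgue" using \<Omega> by (simp add: borel_open)
  define k where "k x = \<phi> x *\<^sub>R h x + \<psi> x *\<^sub>R g x" for x
  have k: "test_function \<Omega> (\<lambda>x. \<phi> x * \<psi> x) k"
    using test_function_mult[OF \<phi> \<psi>] by (simp add: k_def[abs_def])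
  have cont: "continuous_on UNIV k" using k C1_continuous_grad by blast
  have "k x = 0" if "x \<notin> \<Omega>" for x
    using gradient_zero_off_support[of "\<lambda>x. \<phi> x * \<psi> x" k x] k that by blast
  then have "(LINT x|lebesgue_on \<Omega>. k x \<bullet> v) = (LINT x|lebesgue. k x \<bullet> v)"
    unfolding Lebesgue_Measure.integral_restrict_UNIV[OF sets, symmetric]
    by (intro Bochner_Integration.integral_cong) auto
  also have "\<dots> = (LINT x|lborel. k x \<bullet> v)"
    using cont by (intro integral_completion) (auto intro!: borel_measurable_continuous_onI continuous_intros)
  also have "\<dots> = 0"
    using integral_directional_derivative_zero k by blast
  finally have "(LINT x|lebesgue_on \<Omega>. k x \<bullet> v) = 0" .
  moreover have "integrable (lebesgue_on \<Omega>) (\<lambda>x. (\<phi> x *\<^sub>R v) \<bullet> h x)"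
    "integrable (lebesgue_on \<Omega>) (\<lambda>x. (g x \<bullet> v) \<bullet> \<psi> x)"
    by (intro L2_integrable_inner L2_continuous \<Omega> continuous_intros
        C1_continuous[OF conjunct1[OF \<phi>]] C1_continuous[OF \<psi>])+
  ultimately show ?thesis
    by (simp add: ip_def k_def inner_simps inner_commute[of v] mult.commute)
qed

lemma L2_integrable_fun:
  fixes d :: "real ^ 'n \<Rightarrow> real"
  assumes "open \<Omega>" "bounded \<Omega>" "d \<in> L2 \<Omega>"
  shows "integrable (lebesgue_on \<Omega>) d"
  using L2_integrable_inner[OF assms(3) L2_const[OF assms(1,2), of 1]] by simp

text \<open>The difference of two weak divergences is orthogonal to all test functions, in particular to their
  squares; applied to it and to its negative, the localisation lemma shows that it vanishes.\<close>

lemma weak_div_unique: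
  assumes \<Omega>: "open \<Omega>" "bounded \<Omega>" and d: "is_weak_div \<Omega> q d" "is_weak_div \<Omega> q d'"
  shows "AE x in lebesgue_on \<Omega>. d x = d' x"
proof -
  have L2: "d \<in> L2 \<Omega>" "d' \<in> L2 \<Omega>" using d by (auto simp: is_weak_div_def)
  have eq: "(LINT x|lebesgue_on \<Omega>. (\<phi> x)\<^sup>2 * (d x - d' x)) = 0" if \<phi>: "test_function \<Omega> \<phi> g" for \<phi> g
  proof -
    have C1: "C1_with_grad \<phi> g" using \<phi> by blast
    have \<phi>\<phi>: "test_function \<Omega> (\<lambda>x. \<phi> x * \<phi> x) (\<lambda>x. \<phi> x *\<^sub>R g x + \<phi> x *\<^sub>R g x)"
      by (rule test_function_mult[OF \<phi> C1])
    have "(\<lambda>x. \<phi> x * \<phi> x) \<in> L2 \<Omega>"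
      by (intro L2_continuous \<Omega> C1_continuous_fun[OF conjunct1[OF \<phi>\<phi>]])
    moreover have "ip \<Omega> d (\<lambda>x. \<phi> x * \<phi> x) = ip \<Omega> d' (\<lambda>x. \<phi> x * \<phi> x)"
    proof -
      have "ip \<Omega> q (\<lambda>x. \<phi> x *\<^sub>R g x + \<phi> x *\<^sub>R g x) = - ip \<Omega> e (\<lambda>x. \<phi> x * \<phi> x)"
        if "is_weak_div \<Omega> q e" for e
        using that \<phi>\<phi> unfolding is_weak_div_def by blast
      from this[OF d(1)] this[OF d(2)] show ?thesis by simp
    qed
    ultimately have "ip \<Omega> (\<lambda>x. d x - d' x) (\<lambda>x. \<phi> x * \<phi> x) = 0"
      using L2 by (simp add: ip_diff_left)
    then show ?thesis by (simp add: ip_def power2_eq_square mult_ac)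
  qed
  have int: "integrable (lebesgue_on \<Omega>) (\<lambda>x. d x - d' x)"
    using L2 \<Omega> by (intro Bochner_Integration.integrable_diff L2_integrable_fun)
  have "AE x in lebesgue_on \<Omega>. 0 \<le> d x - d' x"
    by (rule AE_nonneg_if_test_squares_nonneg[OF \<Omega>(1) int]) (use eq in fastforce)
  moreover have "AE x in lebesgue_on \<Omega>. 0 \<le> - (d x - d' x)"
  proof (rule AE_nonneg_if_test_squares_nonneg[OF \<Omega>(1)])
    show "integrable (lebesgue_on \<Omega>) (\<lambda>x. - (d x - d' x))"
      using int by (rule integrable_minus)
    fix \<phi> g assume "test_function \<Omega> \<phi> g"
    from eq[OF this] show "0 \<le> (LINT x|lebesgue_on \<Omega>. (\<phi> x)\<^sup>2 * - (d x - d' x))"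
      by (simp only: mult_minus_right integral_minus)
  qed
  ultimately show ?thesis by eventually_elim simp
qed

lemma is_weak_div_wdiv: "q \<in> Hdiv \<Omega> \<Longrightarrow> is_weak_div \<Omega> q (wdiv \<Omega> q)"
  using someI_ex[of "is_weak_div \<Omega> q"] by (auto simp: Hdiv_def wdiv_def)

text \<open>Green's formula shows that \<open>g \<bullet> v\<close> is a weak divergence of \<open>\<phi> v\<close>. The normal trace refers to the
  divergence selected by \<open>wdiv\<close>, which agrees with it almost everywhere by uniqueness; hence the trace
  vanishes on the whole boundary.\<close>

lemma test_field_in_Z_space:
  assumes \<Omega>: "open \<Omega>" "bounded \<Omega>" and \<phi>: "test_function \<Omega> \<phi> g"
  shows "(\<lambda>x. \<phi> x *\<^sub>R v) \<in> Z_space \<Omega> \<Gamma>"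
proof -
  have C1: "C1_with_grad \<phi> g" using \<phi> by blast
  have div: "is_weak_div \<Omega> (\<lambda>x. \<phi> x *\<^sub>R v) (\<lambda>x. g x \<bullet> v)"
    unfolding is_weak_div_def using green_compactly_supported[OF \<Omega> \<phi>]
    by (auto intro!: L2_continuous \<Omega> continuous_intros C1_continuous[OF C1])
  have "(\<lambda>x. \<phi> x *\<^sub>R v) \<in> L2 \<Omega>"
    by (auto intro!: L2_continuous \<Omega> continuous_intros C1_continuous[OF C1])
  with div have Hdiv: "(\<lambda>x. \<phi> x *\<^sub>R v) \<in> Hdiv \<Omega>" by (auto simp: Hdiv_def)
  note wd = is_weak_div_wdiv[OF Hdiv]
  have "ip \<Omega> (\<lambda>x. \<phi> x *\<^sub>R v) h + ip \<Omega> (wdiv \<Omega> (\<lambda>x. \<phi> x *\<^sub>R v)) \<psi> = 0" if \<psi>: "C1_with_grad \<psi> h" for \<psi> h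
  proof -
    have "ip \<Omega> (wdiv \<Omega> (\<lambda>x. \<phi> x *\<^sub>R v)) \<psi> = ip \<Omega> (\<lambda>x. g x \<bullet> v) \<psi>"
    proof (rule ip_cong_AE)
      show "AE x in lebesgue_on \<Omega>. wdiv \<Omega> (\<lambda>x. \<phi> x *\<^sub>R v) x = g x \<bullet> v"
        by (rule weak_div_unique[OF \<Omega> wd div])
      show "\<psi> \<in> borel_measurable (lebesgue_on \<Omega>)"
        by (rule continuous_measurable_lebesgue_on[OF C1_continuous_fun[OF \<psi>]])
    qed (use wd div in \<open>simp_all add: is_weak_div_def L2_measurable\<close>)
    then show ?thesis using green_compactly_supported[OF \<Omega> \<phi> \<psi>] by simp
  qed
  with Hdiv show ?thesis by (auto simp: Z_space_def zero_normal_trace_def)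
qed

lemma test_field_in_X_space:
  assumes "open \<Omega>" "bounded \<Omega>" "test_function \<Omega> \<phi> g"
  shows "(\<lambda>x. \<phi> x *\<^sub>R M) \<in> X_space \<Omega> \<Gamma>"
  using test_field_in_Z_space[OF assms] by (simp add: X_space_def Z_space_def)

section \<open>Coefficient fields\<close>

text \<open>Completeness of Lebesgue measure. It yields measurability of the fields built from \<open>matrix_inv\<close> and
  \<open>op_sqrt\<close>, whose values are controlled almost everywhere only.\<close>

lemma measurable_lebesgue_on_AE:
  fixes f g :: "'a::euclidean_space \<Rightarrow> 'b::euclidean_space"
  assumes "\<Omega> \<in> sets lebesgue" "f \<in> borel_measurable (lebesgue_on \<Omega>)"
    and "AE x in lebesgue_on \<Omega>. f x = g x"
  shows "g \<in> borel_measurable (lebesgue_on \<Omega>)"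
proof (rule borel_measurable_if_D)
  have "AE x in lebesgue. x \<in> \<Omega> \<longrightarrow> f x = g x"
    using assms(1,3) by (subst (asm) AE_restrict_space_iff) auto
  then have "AE x in lebesgue. (if x \<in> \<Omega> then f x else 0) = (if x \<in> \<Omega> then g x else 0)"
    by eventually_elim auto
  with borel_measurable_if_I[OF assms(2,1)]
  show "(\<lambda>x. if x \<in> \<Omega> then g x else 0) \<in> borel_measurable lebesgue"
    by (rule borel_measurable_AE)
qed

lemma measurable_linear_field_apply:
  fixes L :: "'a \<Rightarrow> 'b::euclidean_space \<Rightarrow> 'c::euclidean_space"
  assumes lin: "\<And>x. x \<in> space M \<Longrightarrow> linear (L x)"
    and L: "\<And>v. (\<lambda>x. L x v) \<in> borel_measurable M" and f: "f \<in> borel_measurable M"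
  shows "(\<lambda>x. L x (f x)) \<in> borel_measurable M"
proof -
  have "L x (f x) = (\<Sum>b\<in>Basis. (f x \<bullet> b) *\<^sub>R L x b)" if "x \<in> space M" for x
    using lin[OF that] euclidean_representation[of "f x"]
    by (metis (mono_tags, lifting) linear_scale linear_sum sum.cong)
  moreover have "(\<lambda>x. \<Sum>b\<in>Basis. (f x \<bullet> b) *\<^sub>R L x b) \<in> borel_measurable M"
    using L f by (intro borel_measurable_sum borel_measurable_scaleR borel_measurable_inner) auto
  ultimately show ?thesis
    by (subst measurable_cong) auto
qed

text \<open>The form of a coefficient field controls the coefficient pointwise: the fields \<open>\<phi> v\<close> with a test
  function \<open>\<phi>\<close> localise the inequality, first for \<open>v\<close> in a countable dense set.\<close>

lemma AE_psd_if_psd_on_test_fields: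
  fixes L :: "real ^ 'n \<Rightarrow> 'b::euclidean_space \<Rightarrow> 'b"
  assumes \<Omega>: "open \<Omega>" "bounded \<Omega>"
    and lin: "\<And>x. x \<in> \<Omega> \<Longrightarrow> linear (L x)"
    and meas: "\<And>v. (\<lambda>x. L x v) \<in> borel_measurable (lebesgue_on \<Omega>)"
    and bd: "AE x in lebesgue_on \<Omega>. \<forall>v. norm (L x v) \<le> B * norm v"
    and psd: "\<And>\<phi> g v. test_function \<Omega> \<phi> g \<Longrightarrow>
                0 \<le> ip \<Omega> (\<lambda>x. L x (\<phi> x *\<^sub>R v)) (\<lambda>x. \<phi> x *\<^sub>R v)"
  shows "AE x in lebesgue_on \<Omega>. \<forall>v. 0 \<le> L x v \<bullet> v"
proof -
  obtain D :: "'b set" where D: "countable D" "\<And>U. open U \<Longrightarrow> U \<noteq> {} \<Longrightarrow> \<exists>d\<in>D. d \<in> U"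
    using countable_dense_exists by blast
  have "AE x in lebesgue_on \<Omega>. 0 \<le> L x v \<bullet> v" for v
  proof (rule AE_nonneg_if_test_squares_nonneg[OF \<Omega>(1)])
    have "(\<lambda>x. L x v) \<in> L2 \<Omega>"
      using bd by (intro L2_dominated[OF L2_const[OF \<Omega>, of v] meas, where B = B]) auto
    then show "integrable (lebesgue_on \<Omega>) (\<lambda>x. L x v \<bullet> v)"
      by (rule L2_integrable_inner[OF _ L2_const[OF \<Omega>]])
    fix \<phi> g assume "test_function \<Omega> \<phi> g"
    from psd[OF this, of v]
    have "0 \<le> ip \<Omega> (\<lambda>x. L x (\<phi> x *\<^sub>R v)) (\<lambda>x. \<phi> x *\<^sub>R v)" .
    also have "\<dots> = (LINT x|lebesgue_on \<Omega>. (\<phi> x)\<^sup>2 * (L x v \<bullet> v))"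
      unfolding ip_def
      by (rule Bochner_Integration.integral_cong)
         (use lin in \<open>auto simp: linear_scale power2_eq_square\<close>)
    finally show "0 \<le> (LINT x|lebesgue_on \<Omega>. (\<phi> x)\<^sup>2 * (L x v \<bullet> v))" .
  qed
  then have "AE x in lebesgue_on \<Omega>. \<forall>v\<in>D. 0 \<le> L x v \<bullet> v"
    using D(1) by (simp add: AE_ball_countable)
  moreover have "AE x in lebesgue_on \<Omega>. x \<in> \<Omega>"
    by (rule AE_I2) simp
  ultimately show ?thesis
  proof eventually_elim
    case (elim x)
    have "continuous_on UNIV (\<lambda>v. L x v \<bullet> v)"
      using lin[OF elim(2)]
      by (intro continuous_intros linear_continuous_on) (simp add: linear_conv_bounded_linear)
    then have "open {v. L x v \<bullet> v < 0}"
      by (intro open_Collect_less) auto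
    then have "{v. L x v \<bullet> v < 0} = {}"
      using D(2) elim(1) by fastforce
    then show ?case by (auto simp: not_less[symmetric])
  qed
qed

text \<open>The common structure of the compliance tensor and the inverse permeability: symmetric operators with
  pointwise bounds almost everywhere, in contrast to the integrated bounds of the two tensor predicates.\<close>

locale coefficient_field =
  fixes \<Omega> :: "(real ^ 'n) set" and m M :: real
    and L :: "real ^ 'n \<Rightarrow> 'b::euclidean_space \<Rightarrow> 'b"
  assumes open_domain: "open \<Omega>"
    and linear: "\<And>x. x \<in> \<Omega> \<Longrightarrow> linear (L x)"
    and measurable_const: "\<And>v. (\<lambda>x. L x v) \<in> borel_measurable (lebesgue_on \<Omega>)"
    and AE_sym: "AE x in lebesgue_on \<Omega>. \<forall>v w. L x v \<bullet> w = v \<bullet> L x w"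
    and AE_bounds: "AE x in lebesgue_on \<Omega>. \<forall>v. m * (norm v)\<^sup>2 \<le> L x v \<bullet> v \<and> L x v \<bullet> v \<le> M * (norm v)\<^sup>2"
    and m_nonneg: "0 \<le> m" and M_nonneg: "0 \<le> M"

text \<open>The two bounds say that \<open>L - m I\<close> and \<open>M I - L\<close> are positive semidefinite.\<close>

lemma coefficient_field_from_test_fields:
  fixes L :: "real ^ 'n \<Rightarrow> 'b::euclidean_space \<Rightarrow> 'b"
  assumes \<Omega>: "open \<Omega>" "bounded \<Omega>"
    and lin: "\<And>x. x \<in> \<Omega> \<Longrightarrow> linear (L x)"
    and meas: "\<And>v. (\<lambda>x. L x v) \<in> borel_measurable (lebesgue_on \<Omega>)"
    and sym: "AE x in lebesgue_on \<Omega>. \<forall>v w. L x v \<bullet> w = v \<bullet> L x w"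
    and bd: "AE x in lebesgue_on \<Omega>. \<forall>v. norm (L x v) \<le> B * norm v"
    and bounds: "\<And>\<phi> g v. test_function \<Omega> \<phi> g \<Longrightarrow>
        m * (nrm \<Omega> (\<lambda>x. \<phi> x *\<^sub>R v))\<^sup>2 \<le> ip \<Omega> (\<lambda>x. L x (\<phi> x *\<^sub>R v)) (\<lambda>x. \<phi> x *\<^sub>R v) \<and>
        ip \<Omega> (\<lambda>x. L x (\<phi> x *\<^sub>R v)) (\<lambda>x. \<phi> x *\<^sub>R v) \<le> M * (nrm \<Omega> (\<lambda>x. \<phi> x *\<^sub>R v))\<^sup>2"
    and "0 \<le> m" "0 \<le> M"
  shows "coefficient_field \<Omega> m M L"
proof -
  have shifted: "AE x in lebesgue_on \<Omega>. \<forall>v. 0 \<le> (s *\<^sub>R L x v + c *\<^sub>R v) \<bullet> v"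
    if "\<And>\<phi> g v. test_function \<Omega> \<phi> g \<Longrightarrow>
       0 \<le> s * ip \<Omega> (\<lambda>x. L x (\<phi> x *\<^sub>R v)) (\<lambda>x. \<phi> x *\<^sub>R v) + c * (nrm \<Omega> (\<lambda>x. \<phi> x *\<^sub>R v))\<^sup>2" for s c
  proof (rule AE_psd_if_psd_on_test_fields[OF \<Omega>])
    show "linear (\<lambda>v. s *\<^sub>R L x v + c *\<^sub>R v)" if "x \<in> \<Omega>" for x
      by (intro linear_compose_add linear_compose_scale_right lin that linear_id linear_ident)
    show "(\<lambda>x. s *\<^sub>R L x v + c *\<^sub>R v) \<in> borel_measurable (lebesgue_on \<Omega>)" for v
      using meas[of v] by measurable
    show "AE x in lebesgue_on \<Omega>. \<forall>v. norm (s *\<^sub>R L x v + c *\<^sub>R v) \<le> (\<bar>s\<bar> * B + \<bar>c\<bar>) * norm v"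
      using bd
    proof eventually_elim
      case (elim x)
      show ?case
      proof
        fix v
        have "norm (s *\<^sub>R L x v + c *\<^sub>R v) \<le> \<bar>s\<bar> * norm (L x v) + \<bar>c\<bar> * norm v"
          using norm_triangle_ineq[of "s *\<^sub>R L x v" "c *\<^sub>R v"] by simp
        also have "\<dots> \<le> \<bar>s\<bar> * (B * norm v) + \<bar>c\<bar> * norm v"
          using elim by (intro add_right_mono mult_left_mono) auto
        finally show "norm (s *\<^sub>R L x v + c *\<^sub>R v) \<le> (\<bar>s\<bar> * B + \<bar>c\<bar>) * norm v"
          by (simp add: algebra_simps)
      qed
    qed
    fix \<phi> g and v :: 'b assume \<phi>: "test_function \<Omega> \<phi> g"
    then have "continuous_on UNIV \<phi>" using C1_continuous_fun by blast
    then have \<phi>v: "(\<lambda>x. \<phi> x *\<^sub>R v) \<in> L2 \<Omega>"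
      by (intro L2_continuous \<Omega> continuous_intros)
    have "(\<lambda>x. L x (\<phi> x *\<^sub>R v)) \<in> L2 \<Omega>"
    proof (rule L2_dominated[OF \<phi>v])
      show "(\<lambda>x. L x (\<phi> x *\<^sub>R v)) \<in> borel_measurable (lebesgue_on \<Omega>)"
        by (rule measurable_linear_field_apply[OF _ meas L2_measurable[OF \<phi>v]]) (simp add: lin)
      show "AE x in lebesgue_on \<Omega>. norm (L x (\<phi> x *\<^sub>R v)) \<le> B * norm (\<phi> x *\<^sub>R v)"
        using bd by eventually_elim blast
    qed
    then have "ip \<Omega> (\<lambda>x. s *\<^sub>R L x (\<phi> x *\<^sub>R v) + c *\<^sub>R \<phi> x *\<^sub>R v) (\<lambda>x. \<phi> x *\<^sub>R v)
        = s * ip \<Omega> (\<lambda>x. L x (\<phi> x *\<^sub>R v)) (\<lambda>x. \<phi> x *\<^sub>R v) + c * (nrm \<Omega> (\<lambda>x. \<phi> x *\<^sub>R v))\<^sup>2"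
      using \<phi>v by (subst ip_add_left) (auto intro: L2_scaleR simp only: ip_scaleR_left nrm_power2)
    with that[OF \<phi>]
    show "0 \<le> ip \<Omega> (\<lambda>x. s *\<^sub>R L x (\<phi> x *\<^sub>R v) + c *\<^sub>R \<phi> x *\<^sub>R v) (\<lambda>x. \<phi> x *\<^sub>R v)"
      by (simp only:)
  qed
  have lower: "AE x in lebesgue_on \<Omega>. \<forall>v. 0 \<le> (1 *\<^sub>R L x v + (- m) *\<^sub>R v) \<bullet> v"
    by (rule shifted) (use bounds in fastforce)
  have upper: "AE x in lebesgue_on \<Omega>. \<forall>v. 0 \<le> ((- 1) *\<^sub>R L x v + M *\<^sub>R v) \<bullet> v"
    by (rule shifted) (use bounds in fastforce)
  have "AE x in lebesgue_on \<Omega>. \<forall>v. m * (norm v)\<^sup>2 \<le> L x v \<bullet> v \<and> L x v \<bullet> v \<le> M * (norm v)\<^sup>2"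
    using lower upper by eventually_elim (simp add: inner_simps power2_norm_eq_inner)
  show ?thesis by (rule coefficient_field.intro) (fact | rule assms; assumption)+
qed

lemma norm_matrix_vector_mult_le:
  fixes K :: "real ^ 'n ^ 'm"
  shows "norm (K *v v) \<le> norm K * norm v"
proof (rule power2_le_imp_le)
  have "(norm (K *v v))\<^sup>2 = (\<Sum>i\<in>UNIV. (K $ i \<bullet> v)\<^sup>2)"
    unfolding power2_norm_eq_inner inner_vec_def matrix_vector_mult_def by (simp add: power2_eq_square)
  also have "\<dots> \<le> (\<Sum>i\<in>UNIV. (K $ i \<bullet> K $ i) * (v \<bullet> v))"
    by (intro sum_mono) (rule Cauchy_Schwarz_ineq)
  also have "\<dots> = (norm K * norm v)\<^sup>2"
    by (simp add: power_mult_distrib power2_norm_eq_inner inner_vec_def[of K] sum_distrib_right)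
  finally show "(norm (K *v v))\<^sup>2 \<le> (norm K * norm v)\<^sup>2" .
qed simp

lemma inner_symmetric_matrix:
  fixes K :: "real ^ 'n ^ 'n"
  assumes "transpose K = K"
  shows "(K *v v) \<bullet> w = v \<bullet> (K *v w)"
  using dot_lmul_matrix[of v K w] assms by (metis transpose_matrix_vector)

lemma permeability_coefficient_field:
  assumes \<Omega>: "open \<Omega>" "bounded \<Omega>" and "0 < k_min" "k_min \<le> k_max"
    and K: "permeability_tensor \<Omega> (Z_space \<Omega> \<Gamma>) k_min k_max K"
  shows "coefficient_field \<Omega> k_min k_max (\<lambda>x v. K x *v v)"
proof -
  obtain B where B: "AE x in lebesgue_on \<Omega>. norm (K x) \<le> B"
    using K by (auto simp: permeability_tensor_def)
  have Kmeas: "K \<in> borel_measurable (lebesgue_on \<Omega>)"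
    using K by (simp add: permeability_tensor_def)
  show ?thesis
  proof (rule coefficient_field_from_test_fields[OF \<Omega>])
    show "linear (\<lambda>v. K x *v v)" for x by simp
    show "(\<lambda>x. K x *v v) \<in> borel_measurable (lebesgue_on \<Omega>)" for v
    proof (rule measurable_compose[OF Kmeas])
      show "(\<lambda>A::real^'a^'a. A *v v) \<in> borel_measurable borel"
        by (intro borel_measurable_continuous_onI linear_continuous_on)
           (simp add: linear_conv_bounded_linear[symmetric] linear_iff matrix_vector_mult_add_rdistrib
              scaleR_matrix_vector_assoc)
    qed
    show "AE x in lebesgue_on \<Omega>. \<forall>v w. (K x *v v) \<bullet> w = v \<bullet> (K x *v w)"
      using K by (intro AE_I2) (auto simp: permeability_tensor_def inner_symmetric_matrix)
    show "AE x in lebesgue_on \<Omega>. \<forall>v. norm (K x *v v) \<le> B * norm v"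
      using B by eventually_elim
        (meson norm_matrix_vector_mult_le mult_right_mono norm_ge_zero order_trans)
    fix \<phi> g v assume \<phi>: "test_function \<Omega> \<phi> g"
    have "\<forall>q\<in>Z_space \<Omega> \<Gamma>. k_min * (nrm \<Omega> q)\<^sup>2 \<le> ip \<Omega> (\<lambda>x. K x *v q x) q \<and>
        ip \<Omega> (\<lambda>x. K x *v q x) q \<le> k_max * (nrm \<Omega> q)\<^sup>2"
      using K by (simp add: permeability_tensor_def)
    from bspec[OF this test_field_in_Z_space[OF \<Omega> \<phi>]]
    show "k_min * (nrm \<Omega> (\<lambda>x. \<phi> x *\<^sub>R v))\<^sup>2 \<le> ip \<Omega> (\<lambda>x. K x *v (\<phi> x *\<^sub>R v)) (\<lambda>x. \<phi> x *\<^sub>R v) \<and>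
        ip \<Omega> (\<lambda>x. K x *v (\<phi> x *\<^sub>R v)) (\<lambda>x. \<phi> x *\<^sub>R v) \<le> k_max * (nrm \<Omega> (\<lambda>x. \<phi> x *\<^sub>R v))\<^sup>2"
      by simp
  qed (use assms in auto)
qed

lemma compliance_coefficient_field:
  assumes \<Omega>: "open \<Omega>" "bounded \<Omega>" and "0 < a_min" "a_min \<le> a_max"
    and A: "compliance_tensor \<Omega> (X_space \<Omega> \<Gamma>) a_min a_max A"
  shows "coefficient_field \<Omega> a_min a_max A"
proof -
  obtain B where B: "AE x in lebesgue_on \<Omega>. \<forall>M. norm (A x M) \<le> B * norm M"
    using A by (auto simp: compliance_tensor_def)
  show ?thesis
  proof (rule coefficient_field_from_test_fields[OF \<Omega> _ _ _ B])
    fix \<phi> g v assume \<phi>: "test_function \<Omega> \<phi> g"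
    have "\<forall>\<tau>\<in>X_space \<Omega> \<Gamma>. a_min * (nrm \<Omega> \<tau>)\<^sup>2 \<le> ip \<Omega> (\<lambda>x. A x (\<tau> x)) \<tau> \<and>
        ip \<Omega> (\<lambda>x. A x (\<tau> x)) \<tau> \<le> a_max * (nrm \<Omega> \<tau>)\<^sup>2"
      using A by (simp add: compliance_tensor_def)
    from bspec[OF this test_field_in_X_space[OF \<Omega> \<phi>]]
    show "a_min * (nrm \<Omega> (\<lambda>x. \<phi> x *\<^sub>R v))\<^sup>2 \<le> ip \<Omega> (\<lambda>x. A x (\<phi> x *\<^sub>R v)) (\<lambda>x. \<phi> x *\<^sub>R v) \<and>
        ip \<Omega> (\<lambda>x. A x (\<phi> x *\<^sub>R v)) (\<lambda>x. \<phi> x *\<^sub>R v) \<le> a_max * (nrm \<Omega> (\<lambda>x. \<phi> x *\<^sub>R v))\<^sup>2"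
      by simp
  qed (use assms in \<open>auto simp: compliance_tensor_def\<close>)
qed

text \<open>With \<open>y = K\<^sup>-\<^sup>1 v\<close> the form of the inverse at \<open>v\<close> is the form of \<open>K\<close> at \<open>y\<close>. The lower bound is
  \<open>\<bar>K y\<bar>\<^sup>2 \<le> k_max (K y \<bullet> y)\<close>; the upper one follows from \<open>k_min \<bar>y\<bar> \<le> \<bar>v\<bar>\<close>.\<close>

lemma spd_matrix_inv:
  fixes K :: "real ^ 'n ^ 'n"
  assumes sym: "\<And>v w. (K *v v) \<bullet> w = v \<bullet> (K *v w)"
    and bounds: "\<And>v. k_min * (norm v)\<^sup>2 \<le> (K *v v) \<bullet> v" "\<And>v. (K *v v) \<bullet> v \<le> k_max * (norm v)\<^sup>2"
    and k: "0 < k_min" "0 < k_max"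
  shows spd_matrix_inv_det: "det K \<noteq> 0"
    and spd_matrix_inv_right: "K *v (matrix_inv K *v v) = v"
    and spd_matrix_inv_sym: "(matrix_inv K *v v) \<bullet> w = v \<bullet> (matrix_inv K *v w)"
    and spd_matrix_inv_lower: "1 / k_max * (norm v)\<^sup>2 \<le> (matrix_inv K *v v) \<bullet> v"
    and spd_matrix_inv_upper: "(matrix_inv K *v v) \<bullet> v \<le> 1 / k_min * (norm v)\<^sup>2"
proof -
  have "x = 0" if "K *v x = 0" for x
    using bounds(1)[of x] that k by (simp add: mult_le_0_iff)
  then have inv: "invertible K"
    using invertible_left_inverse matrix_left_invertible_ker by blast
  then show "det K \<noteq> 0" by (simp add: invertible_det_nz)
  have "K ** matrix_inv K = mat 1"
    unfolding matrix_inv_def using someI_ex[OF inv[unfolded invertible_def]] by blast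
  then show right: "K *v (matrix_inv K *v v) = v" for v
    by (simp add: matrix_vector_mul_assoc)
  show "(matrix_inv K *v v) \<bullet> w = v \<bullet> (matrix_inv K *v w)"
    using sym[of "matrix_inv K *v v" "matrix_inv K *v w"] by (simp add: right)
  have psd: "0 \<le> (K *v v) \<bullet> v" for v
    using bounds(1)[of v] k by (smt (verit) mult_nonneg_nonneg zero_le_power2)
  define y where "y = matrix_inv K *v v"
  have Ky: "K *v y = v" by (simp add: y_def right)
  have "(norm (K *v y))\<^sup>2 \<le> k_max * ((K *v y) \<bullet> y)"
    by (rule psd_norm_le_form[OF _ sym psd bounds(2)]) simp
  then show "1 / k_max * (norm v)\<^sup>2 \<le> (matrix_inv K *v v) \<bullet> v"
    unfolding y_def[symmetric] Ky using k by (simp add: field_simps inner_commute)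
  have le: "v \<bullet> y \<le> norm v * norm y" by (rule norm_cauchy_schwarz)
  have "k_min * norm y * norm y \<le> norm v * norm y"
    using bounds(1)[of y] le by (simp add: Ky power2_eq_square mult.assoc)
  then have "k_min * norm y \<le> norm v"
    by (cases "norm y = 0") (auto simp: mult_le_cancel_right)
  then have "norm y \<le> norm v / k_min"
    using k by (simp add: field_simps)
  from le mult_left_mono[OF this norm_ge_zero[of v]]
  show "(matrix_inv K *v v) \<bullet> v \<le> 1 / k_min * (norm v)\<^sup>2"
    unfolding y_def[symmetric] by (simp add: power2_eq_square inner_commute)
qed

lemma borel_measurable_det:
  fixes M :: "'a \<Rightarrow> real ^ 'n ^ 'n"
  assumes "\<And>i j. (\<lambda>x. M x $ i $ j) \<in> borel_measurable N"
  shows "(\<lambda>x. det (M x)) \<in> borel_measurable N"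
  unfolding det_def
  by (intro borel_measurable_sum borel_measurable_times borel_measurable_prod assms) auto

text \<open>Measurability of the inverse comes from Cramer's rule, which expresses it almost everywhere by
  determinants.\<close>

lemma coefficient_field_matrix_inv:
  fixes K :: "real ^ 'n \<Rightarrow> real ^ 'n ^ 'n"
  assumes K: "coefficient_field \<Omega> k_min k_max (\<lambda>x v. K x *v v)"
    and meas: "K \<in> borel_measurable (lebesgue_on \<Omega>)" and k: "0 < k_min" "0 < k_max"
  shows "coefficient_field \<Omega> (1 / k_max) (1 / k_min) (\<lambda>x v. matrix_inv (K x) *v v)"
proof -
  interpret K: coefficient_field \<Omega> k_min k_max "\<lambda>x v. K x *v v" by fact
  have sets: "\<Omega> \<in> sets lebesgue" using K.open_domain by (simp add: borel_open)
  have entry: "(\<lambda>x. K x $ i $ j) \<in> borel_measurable (lebesgue_on \<Omega>)" for i j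
  proof -
    have "(\<lambda>x. K x \<bullet> axis i (axis j 1)) \<in> borel_measurable (lebesgue_on \<Omega>)"
      using meas by measurable
    then show ?thesis by (simp add: inner_axis)
  qed
  show ?thesis
  proof (rule coefficient_field.intro)
    show "(\<lambda>x. matrix_inv (K x) *v v) \<in> borel_measurable (lebesgue_on \<Omega>)" for v
    proof (rule measurable_lebesgue_on_AE[OF sets])
      let ?C = "\<lambda>x. \<chi> k. det (\<chi> i j. if j = k then v $ i else K x $ i $ j) / det (K x)"
      show "?C \<in> borel_measurable (lebesgue_on \<Omega>)"
      proof (rule borel_measurable_vec)
        fix k
        have "(\<lambda>x. det (\<chi> i j. if j = k then v $ i else K x $ i $ j)) \<in> borel_measurable (lebesgue_on \<Omega>)"
        proof (rule borel_measurable_det)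
          fix i j
          show "(\<lambda>x. (\<chi> i j. if j = k then v $ i else K x $ i $ j) $ i $ j) \<in> borel_measurable (lebesgue_on \<Omega>)"
            using entry by (cases "j = k") auto
        qed
        then show "(\<lambda>x. ?C x $ k) \<in> borel_measurable (lebesgue_on \<Omega>)"
          using borel_measurable_det[OF entry] by simp
      qed
      show "AE x in lebesgue_on \<Omega>. ?C x = matrix_inv (K x) *v v"
        using K.AE_sym K.AE_bounds
      proof eventually_elim
        case (elim x)
        have "det (K x) \<noteq> 0"
          by (rule spd_matrix_inv_det[of _ k_min k_max]) (use elim k in auto)
        moreover have "K x *v (matrix_inv (K x) *v v) = v"
          by (rule spd_matrix_inv_right[of _ k_min k_max]) (use elim k in auto)
        ultimately show ?case by (simp add: cramer)
      qed
    qed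
    show "AE x in lebesgue_on \<Omega>. \<forall>v w. (matrix_inv (K x) *v v) \<bullet> w = v \<bullet> (matrix_inv (K x) *v w)"
      using K.AE_sym K.AE_bounds
    proof eventually_elim
      case (elim x)
      show ?case
        by (intro allI spd_matrix_inv_sym[of _ k_min k_max]) (use elim k in auto)
    qed
    show "AE x in lebesgue_on \<Omega>. \<forall>v. 1 / k_max * (norm v)\<^sup>2 \<le> (matrix_inv (K x) *v v) \<bullet> v \<and>
        (matrix_inv (K x) *v v) \<bullet> v \<le> 1 / k_min * (norm v)\<^sup>2"
      using K.AE_sym K.AE_bounds
    proof eventually_elim
      case (elim x)
      show ?case
        by (intro allI conjI spd_matrix_inv_lower[of _ k_min k_max] spd_matrix_inv_upper[of _ k_min k_max])
           (use elim k in auto)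
    qed
  qed (use K.open_domain k in auto)
qed

section \<open>The weighted inner product of a coefficient field\<close>

definition weighted_ip ::
  "(real ^ 'n) set \<Rightarrow> (real ^ 'n \<Rightarrow> 'b \<Rightarrow> 'b) \<Rightarrow> (real ^ 'n \<Rightarrow> 'b::euclidean_space) \<Rightarrow> (real ^ 'n \<Rightarrow> 'b) \<Rightarrow> real" where
  "weighted_ip \<Omega> L f g = ip \<Omega> (\<lambda>x. L x (f x)) g"

context coefficient_field
begin

abbreviation form :: "(real ^ 'n \<Rightarrow> 'b) \<Rightarrow> (real ^ 'n \<Rightarrow> 'b) \<Rightarrow> real" where
  "form \<equiv> weighted_ip \<Omega> L"

lemma sets_domain: "\<Omega> \<in> sets lebesgue"
  using open_domain by (simp add: borel_open)

lemma AE_linear: "AE x in lebesgue_on \<Omega>. linear (L x)"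
  by (rule AE_I2) (simp add: linear)

lemma AE_psd: "AE x in lebesgue_on \<Omega>. \<forall>v. 0 \<le> L x v \<bullet> v"
  using AE_bounds
  by eventually_elim (meson m_nonneg mult_nonneg_nonneg order_trans zero_le_power2)

lemma L2_apply:
  assumes "f \<in> L2 \<Omega>" shows "(\<lambda>x. L x (f x)) \<in> L2 \<Omega>"
proof (rule L2_dominated[OF assms])
  show "(\<lambda>x. L x (f x)) \<in> borel_measurable (lebesgue_on \<Omega>)"
    by (rule measurable_linear_field_apply[OF _ measurable_const L2_measurable[OF assms]]) (simp add: linear)
  show "AE x in lebesgue_on \<Omega>. norm (L x (f x)) \<le> M * norm (f x)"
    using AE_linear AE_sym AE_bounds AE_psd
  proof eventually_elim
    case (elim x)
    show ?case
      by (rule psd_norm_le_bound[of "L x" M]) (use elim M_nonneg in auto)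
  qed
qed

lemma form_commute: "f \<in> L2 \<Omega> \<Longrightarrow> g \<in> L2 \<Omega> \<Longrightarrow> form f g = form g f"
  unfolding weighted_ip_def ip_def
proof (rule integral_cong_AE)
  assume "f \<in> L2 \<Omega>" "g \<in> L2 \<Omega>"
  note [measurable] = L2_apply[THEN L2_measurable, OF this(1)] L2_apply[THEN L2_measurable, OF this(2)]
    L2_measurable[OF this(1)] L2_measurable[OF this(2)]
  show "(\<lambda>x. L x (f x) \<bullet> g x) \<in> borel_measurable (lebesgue_on \<Omega>)"
    "(\<lambda>x. L x (g x) \<bullet> f x) \<in> borel_measurable (lebesgue_on \<Omega>)" by measurable
  show "AE x in lebesgue_on \<Omega>. L x (f x) \<bullet> g x = L x (g x) \<bullet> f x"
    using AE_sym by eventually_elim (metis inner_commute)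
qed

lemma form_diff_left:
  assumes "f \<in> L2 \<Omega>" "g \<in> L2 \<Omega>" "h \<in> L2 \<Omega>"
  shows "form (\<lambda>x. f x - g x) h = form f h - form g h"
proof -
  have "form (\<lambda>x. f x - g x) h = ip \<Omega> (\<lambda>x. L x (f x) - L x (g x)) h"
    unfolding weighted_ip_def ip_def
    by (rule Bochner_Integration.integral_cong) (use linear in \<open>auto simp: linear_diff\<close>)
  then show ?thesis
    using assms by (simp add: ip_diff_left L2_apply weighted_ip_def)
qed

lemma form_scaleR_left: "form (\<lambda>x. c *\<^sub>R f x) h = c * form f h"
proof -
  have "form (\<lambda>x. c *\<^sub>R f x) h = ip \<Omega> (\<lambda>x. c *\<^sub>R L x (f x)) h"
    unfolding weighted_ip_def ip_def
    by (rule Bochner_Integration.integral_cong) (use linear in \<open>auto simp: linear_scale\<close>)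
  then show ?thesis by (simp add: ip_scaleR_left weighted_ip_def)
qed

lemma form_scaleR_right: "form f (\<lambda>x. c *\<^sub>R h x) = c * form f h"
  by (simp add: weighted_ip_def ip_def)

lemma form_diff_right:
  assumes "f \<in> L2 \<Omega>" "g \<in> L2 \<Omega>" "h \<in> L2 \<Omega>"
  shows "form h (\<lambda>x. f x - g x) = form h f - form h g"
  using assms by (simp add: form_commute[of h] form_diff_left L2_diff)

lemma form_bounds:
  assumes "f \<in> L2 \<Omega>"
  shows form_lower: "m * (nrm \<Omega> f)\<^sup>2 \<le> form f f" and form_upper: "form f f \<le> M * (nrm \<Omega> f)\<^sup>2"
proof -
  have int: "integrable (lebesgue_on \<Omega>) (\<lambda>x. L x (f x) \<bullet> f x)" "integrable (lebesgue_on \<Omega>) (\<lambda>x. f x \<bullet> f x)"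
    using assms by (intro L2_integrable_inner L2_apply; assumption)+
  have "m * (nrm \<Omega> f)\<^sup>2 = (LINT x|lebesgue_on \<Omega>. m * (f x \<bullet> f x))"
    "M * (nrm \<Omega> f)\<^sup>2 = (LINT x|lebesgue_on \<Omega>. M * (f x \<bullet> f x))"
    by (auto simp: nrm_power2 ip_def)
  moreover have "AE x in lebesgue_on \<Omega>. m * (f x \<bullet> f x) \<le> L x (f x) \<bullet> f x"
    "AE x in lebesgue_on \<Omega>. L x (f x) \<bullet> f x \<le> M * (f x \<bullet> f x)"
    using AE_bounds by (eventually_elim, simp add: power2_norm_eq_inner)+
  ultimately show "m * (nrm \<Omega> f)\<^sup>2 \<le> form f f" "form f f \<le> M * (nrm \<Omega> f)\<^sup>2"
    unfolding weighted_ip_def ip_def using int by (simp_all only:) (intro integral_mono_AE integrable_mult_right; simp)+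
qed

lemma form_nonneg: "f \<in> L2 \<Omega> \<Longrightarrow> 0 \<le> form f f"
  using form_lower[of f] m_nonneg by (smt (verit) mult_nonneg_nonneg zero_le_power2)

lemma form_cauchy_schwarz:
  assumes "f \<in> L2 \<Omega>" "g \<in> L2 \<Omega>"
  shows "(form f g)\<^sup>2 \<le> form f f * form g g"
proof (rule discriminant_le)
  fix t
  have "0 \<le> form (\<lambda>x. f x - (- t) *\<^sub>R g x) (\<lambda>x. f x - (- t) *\<^sub>R g x)"
    using assms by (intro form_nonneg L2_diff L2_scaleR)
  also have "\<dots> = form f f + 2 * t * form f g + t\<^sup>2 * form g g"
    using assms form_commute[OF assms]
    by (simp add: form_diff_left form_diff_right form_scaleR_left form_scaleR_right L2_diff L2_scaleR
        power2_eq_square algebra_simps del: scaleR_minus_left)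
  finally show "0 \<le> form f f + 2 * t * form f g + t\<^sup>2 * form g g" .
qed (rule form_nonneg[OF assms(2)])

text \<open>The arithmetic-geometric mean inequality applied to Cauchy--Schwarz.\<close>

lemma form_young:
  assumes "f \<in> L2 \<Omega>" "g \<in> L2 \<Omega>"
  shows "2 * \<bar>form f g\<bar> \<le> form f f + form g g"
proof (rule power2_le_imp_le)
  have "(2 * \<bar>form f g\<bar>)\<^sup>2 = 4 * (form f g)\<^sup>2" by (simp add: power_mult_distrib)
  also have "\<dots> \<le> 4 * (form f f * form g g)"
    using form_cauchy_schwarz[OF assms] by simp
  also have "\<dots> \<le> (form f f + form g g)\<^sup>2"
    using zero_le_power2[of "form f f - form g g"] by (simp add: power2_eq_square algebra_simps)
  finally show "(2 * \<bar>form f g\<bar>)\<^sup>2 \<le> (form f f + form g g)\<^sup>2" .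
qed (simp add: form_nonneg assms)

text \<open>Only the left factor keeps its weighted norm. With the right factor a test field, this has the shape
  that the inf-sup conditions need.\<close>

lemma form_le_norms:
  assumes "f \<in> L2 \<Omega>" "g \<in> L2 \<Omega>"
  shows "\<bar>form f g\<bar> \<le> sqrt (form f f) * (sqrt M * nrm \<Omega> g)"
proof -
  have "\<bar>form f g\<bar> \<le> sqrt (form f f * form g g)"
    using form_cauchy_schwarz[OF assms] by (rule real_le_rsqrt[of "\<bar>form f g\<bar>", simplified])
  also have "\<dots> \<le> sqrt (form f f * (M * (nrm \<Omega> g)\<^sup>2))"
    using form_upper[OF assms(2)] form_nonneg[OF assms(1)] by (intro real_sqrt_le_mono mult_left_mono)
  finally show ?thesis by (simp add: real_sqrt_mult nrm_nonneg)
qed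

text \<open>The norm \<open>\<parallel>A\<^sup>1\<^sup>/\<^sup>2 \<sigma>\<parallel>\<close> of the stability estimate is the energy norm. The squared length of the square root
  is measurable because it agrees almost everywhere with the integrand of the form.\<close>

lemma nrm_op_sqrt:
  assumes "f \<in> L2 \<Omega>"
  shows "(nrm \<Omega> (\<lambda>x. op_sqrt (L x) (f x)))\<^sup>2 = form f f"
proof -
  have eq: "AE x in lebesgue_on \<Omega>. L x (f x) \<bullet> f x = op_sqrt (L x) (f x) \<bullet> op_sqrt (L x) (f x)"
    using AE_linear AE_sym AE_psd by eventually_elim (simp add: inner_op_sqrt)
  have "(\<lambda>x. L x (f x) \<bullet> f x) \<in> borel_measurable (lebesgue_on \<Omega>)"
    using L2_integrable_inner[OF L2_apply[OF assms] assms] by auto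
  from integral_cong_AE[OF this measurable_lebesgue_on_AE[OF sets_domain this eq] eq]
  show ?thesis by (simp add: nrm_power2 weighted_ip_def ip_def)
qed

end

section \<open>The discrete spaces\<close>

lemma fe_space_diff:
  assumes "fe_space \<T> S" "f \<in> S" "g \<in> S"
  shows "(\<lambda>x. f x - g x) \<in> S"
proof -
  obtain m :: nat and b where S: "S = {f. \<exists>c :: nat \<Rightarrow> real. f = (\<lambda>x. \<Sum>i<m. c i *\<^sub>R b i x)}"
    using assms(1) unfolding fe_space_def by blast
  obtain c d where "f = (\<lambda>x. \<Sum>i<m. c i *\<^sub>R b i x)" "g = (\<lambda>x. \<Sum>i<m. d i *\<^sub>R b i x)"
    using assms(2,3) unfolding S by blast
  then have "(\<lambda>x. f x - g x) = (\<lambda>x. \<Sum>i<m. (c i - d i) *\<^sub>R b i x)"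
    by (simp add: sum_subtractf scaleR_diff_left)
  then show ?thesis unfolding S mem_Collect_eq by (rule exI[of _ "\<lambda>i. c i - d i"])
qed

lemma fe_space_scaleR:
  assumes "fe_space \<T> S" "f \<in> S"
  shows "(\<lambda>x. t *\<^sub>R f x) \<in> S"
proof -
  obtain m :: nat and b where S: "S = {f. \<exists>c :: nat \<Rightarrow> real. f = (\<lambda>x. \<Sum>i<m. c i *\<^sub>R b i x)}"
    using assms(1) unfolding fe_space_def by blast
  obtain c where "f = (\<lambda>x. \<Sum>i<m. c i *\<^sub>R b i x)"
    using assms(2) unfolding S by blast
  then have "(\<lambda>x. t *\<^sub>R f x) = (\<lambda>x. \<Sum>i<m. (t * c i) *\<^sub>R b i x)"
    by (simp add: scaleR_sum_right)
  then show ?thesis unfolding S mem_Collect_eq by (rule exI[of _ "\<lambda>i. t * c i"])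
qed

lemma X_space_L2: "\<tau> \<in> X_space \<Omega> \<Gamma> \<Longrightarrow> \<tau> \<in> L2 \<Omega>"
  by (rule L2_components) (simp add: X_space_def Hdiv_def)

lemma Z_space_L2:
  assumes "q \<in> Z_space \<Omega> \<Gamma>"
  shows "q \<in> L2 \<Omega>" and wdiv_L2: "wdiv \<Omega> q \<in> L2 \<Omega>"
  using assms is_weak_div_wdiv[of q \<Omega>] by (auto simp: Z_space_def Hdiv_def is_weak_div_def)

lemma nrm_le_mhdiv_norm: "nrm \<Omega> \<tau> \<le> mhdiv_norm \<Omega> \<tau>"
  unfolding mhdiv_norm_def by (rule real_le_rsqrt) simp

lemma nrm_le_hdiv_norm: "nrm \<Omega> q \<le> hdiv_norm \<Omega> q"
  unfolding hdiv_norm_def by (rule real_le_rsqrt) simp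

text \<open>A supremum over the empty set is an unspecified real number. When every test field has norm zero,
  the hypothesis is therefore exploited for all multiples \<open>t\<close> of the estimated function.\<close>

lemma SUP_quotient_bound:
  fixes N b :: "'a \<Rightarrow> real"
  assumes le: "\<And>t. 0 \<le> t \<Longrightarrow> t * a \<le> C * (SUP \<tau>\<in>{\<tau>\<in>X. N \<tau> \<noteq> 0}. (t * b \<tau>) / N \<tau>)"
    and bound: "\<And>\<tau>. \<tau> \<in> X \<Longrightarrow> b \<tau> \<le> D * N \<tau>"
    and nonneg: "\<And>\<tau>. 0 \<le> N \<tau>" "0 \<le> C" "0 \<le> D"
  shows "a \<le> C * D"
proof (cases "{\<tau>\<in>X. N \<tau> \<noteq> 0} = {}")
  case True
  define s where "s = C * Sup ({} :: real set)"
  have le_s: "t * a \<le> s" if "0 \<le> t" for t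
    using le[OF that] unfolding True s_def by simp
  have "a \<le> 0"
  proof (rule ccontr)
    assume "\<not> a \<le> 0"
    then show False using le_s[of "(\<bar>s\<bar> + 1) / a"] by (simp split: if_splits)
  qed
  also have "0 \<le> C * D" using nonneg by simp
  finally show ?thesis .
next
  case False
  have "a \<le> C * (SUP \<tau>\<in>{\<tau>\<in>X. N \<tau> \<noteq> 0}. b \<tau> / N \<tau>)"
    using le[of 1] by simp
  also have "\<dots> \<le> C * D"
  proof (intro mult_left_mono cSUP_least False nonneg)
    fix \<tau> assume "\<tau> \<in> {\<tau>\<in>X. N \<tau> \<noteq> 0}"
    then have "0 < N \<tau>" "\<tau> \<in> X" using nonneg(1)[of \<tau>] by auto
    then show "b \<tau> / N \<tau> \<le> D" using bound by (simp add: pos_divide_le_eq)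
  qed
  finally show ?thesis .
qed

text \<open>The quotient by \<open>hdiv_norm\<close> is at most \<open>D\<close>, because that norm dominates the \<open>L\<^sup>2\<close> norm.\<close>

lemma inf_sup_flow_bound:
  assumes "inf_sup_flow \<Omega> Zh Wh C" "0 \<le> C" "fe_space \<T> Wh" "w \<in> Wh"
    and "\<And>q. q \<in> Zh \<Longrightarrow> ip \<Omega> (wdiv \<Omega> q) w \<le> D * nrm \<Omega> q" "0 \<le> D"
  shows "nrm \<Omega> w \<le> C * D"
proof (rule SUP_quotient_bound[where N = "hdiv_norm \<Omega>" and b = "\<lambda>q. ip \<Omega> (wdiv \<Omega> q) w" and X = Zh])
  show "t * nrm \<Omega> w \<le> C * (SUP q\<in>{q \<in> Zh. hdiv_norm \<Omega> q \<noteq> 0}. t * ip \<Omega> (wdiv \<Omega> q) w / hdiv_norm \<Omega> q)"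
    if "0 \<le> t" for t
  proof -
    have "nrm \<Omega> (\<lambda>x. t *\<^sub>R w x) \<le> C * (SUP q\<in>{q \<in> Zh. hdiv_norm \<Omega> q \<noteq> 0}.
          ip \<Omega> (wdiv \<Omega> q) (\<lambda>x. t *\<^sub>R w x) / hdiv_norm \<Omega> q)"
      using assms(1) fe_space_scaleR[OF assms(3,4), of t] unfolding inf_sup_flow_def by blast
    then show ?thesis
      using that by (simp only: ip_scaleR_right nrm_scaleR abs_of_nonneg)
  qed
  show "ip \<Omega> (wdiv \<Omega> q) w \<le> D * hdiv_norm \<Omega> q" if "q \<in> Zh" for q
    using assms(5)[OF that] mult_left_mono[OF nrm_le_hdiv_norm[of \<Omega> q] assms(6)] by linarith
qed (use assms in \<open>auto simp: hdiv_norm_def\<close>)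

lemma inf_sup_elasticity_bound:
  assumes "inf_sup_elasticity \<Omega> Xh Vh Qh C" "0 \<le> C"
    and fe: "fe_space \<T> Vh" "v \<in> Vh" "fe_space \<T>' Qh" "\<xi> \<in> Qh"
    and "\<And>\<tau>. \<tau> \<in> Xh \<Longrightarrow> ip \<Omega> v (mdiv \<Omega> \<tau>) + ip \<Omega> \<xi> \<tau> \<le> D * nrm \<Omega> \<tau>" "0 \<le> D"
  shows "nrm \<Omega> v + nrm \<Omega> \<xi> \<le> C * D"
proof (rule SUP_quotient_bound[where N = "mhdiv_norm \<Omega>" and X = Xh
      and b = "\<lambda>\<tau>. ip \<Omega> v (mdiv \<Omega> \<tau>) + ip \<Omega> \<xi> \<tau>"])
  show "t * (nrm \<Omega> v + nrm \<Omega> \<xi>) \<le> C * (SUP \<tau>\<in>{\<tau> \<in> Xh. mhdiv_norm \<Omega> \<tau> \<noteq> 0}.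
          t * (ip \<Omega> v (mdiv \<Omega> \<tau>) + ip \<Omega> \<xi> \<tau>) / mhdiv_norm \<Omega> \<tau>)" if "0 \<le> t" for t
  proof -
    have "nrm \<Omega> (\<lambda>x. t *\<^sub>R v x) + nrm \<Omega> (\<lambda>x. t *\<^sub>R \<xi> x) \<le>
        C * (SUP \<tau>\<in>{\<tau> \<in> Xh. mhdiv_norm \<Omega> \<tau> \<noteq> 0}.
          (ip \<Omega> (\<lambda>x. t *\<^sub>R v x) (mdiv \<Omega> \<tau>) + ip \<Omega> (\<lambda>x. t *\<^sub>R \<xi> x) \<tau>) / mhdiv_norm \<Omega> \<tau>)"
      using assms(1) fe_space_scaleR[OF fe(1,2), of t] fe_space_scaleR[OF fe(3,4), of t]
      unfolding inf_sup_elasticity_def by blast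
    then show ?thesis
      using that by (simp only: ip_scaleR_left nrm_scaleR abs_of_nonneg distrib_left)
  qed
  show "ip \<Omega> v (mdiv \<Omega> \<tau>) + ip \<Omega> \<xi> \<tau> \<le> D * mhdiv_norm \<Omega> \<tau>" if "\<tau> \<in> Xh" for \<tau>
    using assms(7)[OF that] mult_left_mono[OF nrm_le_mhdiv_norm[of \<Omega> \<tau>] assms(8)] by linarith
qed (use assms in \<open>auto simp: mhdiv_norm_def\<close>)

section \<open>Energy estimates for the scheme\<close>

lemma nrm_mult_mat_1:
  fixes p :: "real ^ 'n \<Rightarrow> real"
  shows "(nrm \<Omega> (\<lambda>x. (c * p x) *\<^sub>R (mat 1 :: real ^ 'n ^ 'n)))\<^sup>2 = c\<^sup>2 * CARD('n) * (nrm \<Omega> p)\<^sup>2"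
proof -
  have "(mat 1 :: real ^ 'n ^ 'n) \<bullet> mat 1 = CARD('n)"
    by (simp add: inner_vec_def mat_def mult_if_delta)
  moreover have "ip \<Omega> (\<lambda>x. (c * p x) *\<^sub>R (mat 1 :: real ^ 'n ^ 'n)) (\<lambda>x. (c * p x) *\<^sub>R mat 1)
      = (LINT x|lebesgue_on \<Omega>. (c\<^sup>2 * ((mat 1 :: real ^ 'n ^ 'n) \<bullet> mat 1)) * (p x \<bullet> p x))"
    unfolding ip_def by (rule Bochner_Integration.integral_cong) (auto simp: power2_eq_square)
  ultimately show ?thesis by (simp add: nrm_power2 ip_def)
qed

text \<open>A discrete solution, with the data of the problem reduced to what the energy argument uses: the
  compliance and the inverse permeability as coefficient fields, and the conformity of the spaces.\<close>

locale drained_split =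
  fixes \<Omega> :: "(real ^ 'n) set" and A K and \<alpha> c\<^sub>0 \<Delta>t a_min a_max k_min k_max :: real and N :: nat
    and Xh Vh Qh Zh Wh \<sigma> u \<gamma> z p \<Gamma> \<Gamma>' \<T>
  assumes compliance: "coefficient_field \<Omega> a_min a_max A"
    and permeability: "coefficient_field \<Omega> (1 / k_max) (1 / k_min) (\<lambda>x v. matrix_inv (K x) *v v)"
    and k_min: "0 < k_min" and k_max: "0 < k_max" and dt: "0 < \<Delta>t" and c\<^sub>0: "0 \<le> c\<^sub>0"
    and X: "Xh \<subseteq> X_space \<Omega> \<Gamma>" and V: "Vh \<subseteq> L2 \<Omega>" and Q: "Qh \<subseteq> L2 \<Omega>"
    and Z: "Zh \<subseteq> Z_space \<Omega> \<Gamma>'" and W: "Wh \<subseteq> L2 \<Omega>"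
    and feV: "fe_space \<T> Vh" and feQ: "fe_space \<T> Qh" and feW: "fe_space \<T> Wh"
    and solution: "drained_split_solution \<Omega> A K \<alpha> c\<^sub>0 \<Delta>t N Xh Vh Qh Zh Wh \<sigma> u \<gamma> z p"
begin

sublocale A: coefficient_field \<Omega> a_min a_max A by (rule compliance)
sublocale Kinv: coefficient_field \<Omega> "1 / k_max" "1 / k_min" "\<lambda>x v. matrix_inv (K x) *v v"
  by (rule permeability)

lemma members:
  assumes "k \<le> N"
  shows "\<sigma> k \<in> Xh" "u k \<in> Vh" "\<gamma> k \<in> Qh" "z k \<in> Zh" "p k \<in> Wh"
  using solution assms by (auto simp: drained_split_solution_def)

lemma L2_members:
  assumes "k \<le> N"
  shows "\<sigma> k \<in> L2 \<Omega>" "z k \<in> L2 \<Omega>" "p k \<in> L2 \<Omega>"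
  using members[OF assms] X Z W X_space_L2 Z_space_L2 by blast+

text \<open>The truncated subtraction \<open>0 - 1 = 0\<close> on natural numbers turns the convention \<open>p\<^sup>-\<^sup>1 = p\<^sup>0\<close> into the
  general form of the lagged pressure.\<close>

lemma level:
  assumes "k \<le> N"
  shows "level_equations \<Omega> A K \<alpha> Xh Vh Qh Zh (p (k - 1)) (\<sigma> k) (u k) (\<gamma> k) (z k) (p k)"
  using solution assms by (cases k) (auto simp: drained_split_solution_def)

definition pressure_stress :: "nat \<Rightarrow> real ^ 'n \<Rightarrow> real ^ 'n ^ 'n" where
  "pressure_stress k x = (\<alpha> * p k x) *\<^sub>R mat 1"

lemma L2_pressure_stress: "k \<le> N \<Longrightarrow> pressure_stress k \<in> L2 \<Omega>"
  using L2_scale_const[OF L2_scaleR[OF L2_members(3)], of k \<alpha> "mat 1"] by (simp add: pressure_stress_def[abs_def])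

lemma stress_equation:
  assumes "k \<le> N" "\<tau> \<in> Xh"
  shows "A.form (\<sigma> k) \<tau> + ip \<Omega> (u k) (mdiv \<Omega> \<tau>) + ip \<Omega> (\<gamma> k) \<tau> = - A.form (pressure_stress (k - 1)) \<tau>"
  using level[OF assms(1)] assms(2) by (simp add: level_equations_def weighted_ip_def pressure_stress_def)

lemma darcy_equation:
  assumes "k \<le> N" "q \<in> Zh"
  shows "Kinv.form (z k) q = ip \<Omega> (p k) (wdiv \<Omega> q)"
  using level[OF assms(1)] assms(2) unfolding level_equations_def weighted_ip_def
  by auto

text \<open>The stress \<open>\<sigma>\<^sup>j\<close> is a test field that annihilates displacement and rotation, because its divergence
  is orthogonal to \<open>V\<^sub>h\<close> and it is itself orthogonal to \<open>Q\<^sub>h\<close>.\<close>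

lemma stress_tested_with_stress:
  assumes "i \<le> N" "j \<le> N"
  shows "A.form (\<sigma> i) (\<sigma> j) = - A.form (pressure_stress (i - 1)) (\<sigma> j)"
proof -
  have "ip \<Omega> (u i) (mdiv \<Omega> (\<sigma> j)) = 0" "ip \<Omega> (\<gamma> i) (\<sigma> j) = 0"
    using level[OF assms(2)] members[OF assms(1)] unfolding level_equations_def
    by (simp_all add: ip_commute)
  then show ?thesis
    using stress_equation[OF assms(1) members(1)[OF assms(2)]] by simp
qed

text \<open>Truncated subtraction makes all increments vanish at level \<open>0\<close>. This agrees with \<open>p\<^sup>-\<^sup>1 = p\<^sup>0\<close> and
  starts the telescoping sum at zero.\<close>

definition pressure_inc :: "nat \<Rightarrow> real ^ 'n \<Rightarrow> real" where
  "pressure_inc k x = p k x - p (k - 1) x"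

definition pressure_stress_inc :: "nat \<Rightarrow> real ^ 'n \<Rightarrow> real ^ 'n ^ 'n" where
  "pressure_stress_inc k x = pressure_stress k x - pressure_stress (k - 1) x"

definition stress_inc :: "nat \<Rightarrow> real ^ 'n \<Rightarrow> real ^ 'n ^ 'n" where
  "stress_inc k x = \<sigma> k x - \<sigma> (k - 1) x"

lemma L2_increments:
  assumes "k \<le> N"
  shows "pressure_inc k \<in> L2 \<Omega>" "pressure_stress_inc k \<in> L2 \<Omega>" "stress_inc k \<in> L2 \<Omega>"
  unfolding pressure_inc_def[abs_def] pressure_stress_inc_def[abs_def] stress_inc_def[abs_def]
  by (intro L2_diff L2_members L2_pressure_stress; use assms in linarith)+

text \<open>Subtract the stress equations of two consecutive levels, tested with the stress increment. Their
  right-hand sides contain the pressures one level earlier, which is why level \<open>n\<close> bounds level \<open>n + 1\<close>.\<close>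

lemma stress_increment_le:
  assumes "n < N"
  shows "A.form (stress_inc (Suc n)) (stress_inc (Suc n)) \<le> A.form (pressure_stress_inc n) (pressure_stress_inc n)"
proof -
  have le: "Suc n \<le> N" "n \<le> N" "n - 1 \<le> N" using assms by auto
  have "A.form (stress_inc (Suc n)) (\<sigma> j) = - A.form (pressure_stress_inc n) (\<sigma> j)" if "j \<le> N" for j
  proof -
    note \<sigma>j = L2_members(1)[OF that]
    have "A.form (stress_inc (Suc n)) (\<sigma> j) = A.form (\<sigma> (Suc n)) (\<sigma> j) - A.form (\<sigma> n) (\<sigma> j)"
      using A.form_diff_left[OF L2_members(1)[OF le(1)] L2_members(1)[OF le(2)] \<sigma>j]
      by (simp add: stress_inc_def[abs_def])
    moreover have "A.form (pressure_stress_inc n) (\<sigma> j) = A.form (pressure_stress n) (\<sigma> j) - A.form (pressure_stress (n - 1)) (\<sigma> j)"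
      using A.form_diff_left[OF L2_pressure_stress[OF le(2)] L2_pressure_stress[OF le(3)] \<sigma>j]
      by (simp add: pressure_stress_inc_def[abs_def])
    ultimately show ?thesis
      using stress_tested_with_stress[OF le(1) that] stress_tested_with_stress[OF le(2) that] by simp
  qed
  from this[of "Suc n"] this[of n]
  have eq: "A.form (stress_inc (Suc n)) (stress_inc (Suc n)) = - A.form (pressure_stress_inc n) (stress_inc (Suc n))"
    unfolding stress_inc_def[of "Suc n", abs_def] using L2_increments(3)[OF le(1)]
    by (simp add: A.form_diff_right L2_members L2_increments le stress_inc_def[abs_def])
  have "2 * \<bar>A.form (pressure_stress_inc n) (stress_inc (Suc n))\<bar>
      \<le> A.form (pressure_stress_inc n) (pressure_stress_inc n) + A.form (stress_inc (Suc n)) (stress_inc (Suc n))"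
    by (rule A.form_young) (simp_all add: L2_increments le)
  with eq show ?thesis by linarith
qed

text \<open>The pressure increment is replaced by the flux increment through the difference of two Darcy
  equations, and \<open>2 (K\<^sup>-\<^sup>1 (z - z'), z) \<ge> (K\<^sup>-\<^sup>1 z, z) - (K\<^sup>-\<^sup>1 z', z')\<close>.\<close>

lemma flow_increment:
  assumes "n < N"
  shows "Kinv.form (z (Suc n)) (z (Suc n)) - Kinv.form (z n) (z n)
           \<le> 2 * ip \<Omega> (wdiv \<Omega> (z (Suc n))) (pressure_inc (Suc n))"
proof -
  have le: "Suc n \<le> N" "n \<le> N" using assms by auto
  note q = members(4)[OF le(1)]
  have "wdiv \<Omega> (z (Suc n)) \<in> L2 \<Omega>" using q Z wdiv_L2 by blast
  then have "ip \<Omega> (wdiv \<Omega> (z (Suc n))) (pressure_inc (Suc n))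
      = ip \<Omega> (p (Suc n)) (wdiv \<Omega> (z (Suc n))) - ip \<Omega> (p n) (wdiv \<Omega> (z (Suc n)))"
    using le by (subst ip_commute) (simp add: pressure_inc_def[abs_def] ip_diff_left L2_members)
  also have "\<dots> = Kinv.form (z (Suc n)) (z (Suc n)) - Kinv.form (z n) (z (Suc n))"
    by (simp add: darcy_equation le q)
  finally show ?thesis
    using Kinv.form_young[of "z n" "z (Suc n)"] L2_members le by fastforce
qed

text \<open>The storage equation tested with the pressure increment. The coupling term on its right-hand side
  is absorbed by Young's inequality; the lagged part reappears in the estimate one level earlier, which
  makes the sum telescope.\<close>

lemma storage_step:
  assumes "n < N"
  shows "c\<^sub>0 / \<Delta>t * (nrm \<Omega> (pressure_inc (Suc n)))\<^sup>2
      + 1 / (2 * \<Delta>t) * (A.form (pressure_stress_inc (Suc n)) (pressure_stress_inc (Suc n)) - A.form (pressure_stress_inc n) (pressure_stress_inc n))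
      + 1 / 2 * (Kinv.form (z (Suc n)) (z (Suc n)) - Kinv.form (z n) (z n)) \<le> 0"
proof -
  have le: "Suc n \<le> N" using assms by auto
  let ?P = "pressure_inc (Suc n)" and ?E = "pressure_stress_inc (Suc n)" and ?S = "stress_inc (Suc n)"
  have "?P \<in> Wh"
    unfolding pressure_inc_def[abs_def] using assms by (intro fe_space_diff[OF feW] members) auto
  have E: "?E = (\<lambda>x. \<alpha> *\<^sub>R (?P x *\<^sub>R mat 1))"
    by (simp add: fun_eq_iff pressure_stress_inc_def pressure_stress_def pressure_inc_def algebra_simps)
  have "c\<^sub>0 * ip \<Omega> (\<lambda>x. ?P x / \<Delta>t) ?P
      + \<alpha> * ip \<Omega> (\<lambda>x. A x ((\<alpha> * (?P x / \<Delta>t)) *\<^sub>R mat 1)) (\<lambda>x. ?P x *\<^sub>R mat 1)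
      + ip \<Omega> (wdiv \<Omega> (z (Suc n))) ?P
      = - \<alpha> * ip \<Omega> (\<lambda>x. A x ((1 / \<Delta>t) *\<^sub>R ?S x)) (\<lambda>x. ?P x *\<^sub>R mat 1)"
    using solution assms \<open>?P \<in> Wh\<close> unfolding drained_split_solution_def pressure_inc_def stress_inc_def by simp
  moreover have "ip \<Omega> (\<lambda>x. ?P x / \<Delta>t) ?P = 1 / \<Delta>t * (nrm \<Omega> ?P)\<^sup>2"
    using ip_scaleR_left[of \<Omega> "1 / \<Delta>t" ?P ?P] by (simp add: nrm_power2)
  moreover have "\<alpha> * ip \<Omega> (\<lambda>x. A x ((\<alpha> * (?P x / \<Delta>t)) *\<^sub>R mat 1)) (\<lambda>x. ?P x *\<^sub>R mat 1)
      = 1 / \<Delta>t * A.form ?E ?E"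
  proof -
    have "\<alpha> * ip \<Omega> (\<lambda>x. A x ((\<alpha> * (?P x / \<Delta>t)) *\<^sub>R mat 1)) (\<lambda>x. ?P x *\<^sub>R mat 1)
        = \<alpha> * A.form (\<lambda>x. (1 / \<Delta>t) *\<^sub>R ?E x) (\<lambda>x. ?P x *\<^sub>R mat 1)"
      by (simp add: weighted_ip_def E)
    also have "\<dots> = 1 / \<Delta>t * (\<alpha> * A.form ?E (\<lambda>x. ?P x *\<^sub>R mat 1))"
      by (simp only: A.form_scaleR_left mult.left_commute)
    also have "\<alpha> * A.form ?E (\<lambda>x. ?P x *\<^sub>R mat 1) = A.form ?E ?E"
      by (subst (3) E) (simp only: A.form_scaleR_right)
    finally show ?thesis .
  qed
  moreover have "\<alpha> * ip \<Omega> (\<lambda>x. A x ((1 / \<Delta>t) *\<^sub>R ?S x)) (\<lambda>x. ?P x *\<^sub>R mat 1) = 1 / \<Delta>t * A.form ?S ?E"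
  proof -
    have "ip \<Omega> (\<lambda>x. A x ((1 / \<Delta>t) *\<^sub>R ?S x)) (\<lambda>x. ?P x *\<^sub>R mat 1)
        = A.form (\<lambda>x. (1 / \<Delta>t) *\<^sub>R ?S x) (\<lambda>x. ?P x *\<^sub>R mat 1)"
      by (simp only: weighted_ip_def)
    then show ?thesis
      by (simp only: E A.form_scaleR_left A.form_scaleR_right mult.left_commute)
  qed
  ultimately have balance: "c\<^sub>0 / \<Delta>t * (nrm \<Omega> ?P)\<^sup>2 + 1 / \<Delta>t * A.form ?E ?E + ip \<Omega> (wdiv \<Omega> (z (Suc n))) ?P
      = - (1 / \<Delta>t * A.form ?S ?E)"
    by simp
  have "2 * \<bar>A.form ?S ?E\<bar> \<le> A.form ?S ?S + A.form ?E ?E"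
    by (rule A.form_young) (simp_all add: L2_increments le)
  then have "- A.form ?S ?E \<le> 1 / 2 * (A.form (pressure_stress_inc n) (pressure_stress_inc n) + A.form ?E ?E)"
    using stress_increment_le[OF assms] abs_ge_minus_self[of "A.form ?S ?E"] by argo
  from mult_left_mono[OF this, of "1 / \<Delta>t"] dt
  have "- (1 / \<Delta>t * A.form ?S ?E)
      \<le> 1 / (2 * \<Delta>t) * A.form (pressure_stress_inc n) (pressure_stress_inc n) + 1 / (2 * \<Delta>t) * A.form ?E ?E"
    by (simp add: algebra_simps)
  moreover have "1 / \<Delta>t * A.form ?E ?E = 1 / (2 * \<Delta>t) * A.form ?E ?E + 1 / (2 * \<Delta>t) * A.form ?E ?E"
    by (simp add: field_simps)
  ultimately show ?thesis
    using balance flow_increment[OF assms] by (simp only: right_diff_distrib)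
qed

lemma energy_estimate:
  assumes "m \<le> N"
  shows "(\<Sum>n<m. c\<^sub>0 / \<Delta>t * (nrm \<Omega> (pressure_inc (Suc n)))\<^sup>2) + 1 / (2 * \<Delta>t) * A.form (pressure_stress_inc m) (pressure_stress_inc m)
      + 1 / 2 * Kinv.form (z m) (z m) \<le> 1 / 2 * Kinv.form (z 0) (z 0)"
  using assms
proof (induction m)
  case 0
  have "A.form (pressure_stress_inc 0) (pressure_stress_inc 0) = 0"
    by (simp add: weighted_ip_def ip_def pressure_stress_inc_def)
  then show ?case by simp
next
  case (Suc m)
  from Suc.IH Suc.prems storage_step[of m] show ?case
    by (simp only: sum.lessThan_Suc right_diff_distrib) linarith
qed

lemma flux_bound:
  assumes "k \<le> N"
  shows "(nrm \<Omega> (z k))\<^sup>2 \<le> k_max / k_min * (nrm \<Omega> (z 0))\<^sup>2"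
proof -
  have "0 \<le> (\<Sum>n<k. c\<^sub>0 / \<Delta>t * (nrm \<Omega> (pressure_inc (Suc n)))\<^sup>2)"
    using c\<^sub>0 dt by (intro sum_nonneg) simp
  moreover have "0 \<le> 1 / (2 * \<Delta>t) * A.form (pressure_stress_inc k) (pressure_stress_inc k)"
    using dt assms by (simp add: A.form_nonneg L2_increments)
  ultimately have "Kinv.form (z k) (z k) \<le> Kinv.form (z 0) (z 0)"
    using energy_estimate[OF assms] by linarith
  then have "1 / k_max * (nrm \<Omega> (z k))\<^sup>2 \<le> 1 / k_min * (nrm \<Omega> (z 0))\<^sup>2"
    using Kinv.form_lower[of "z k"] Kinv.form_upper[of "z 0"] L2_members assms by fastforce
  then show ?thesis using k_min k_max by (simp add: field_simps)
qed

lemma storage_bound: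
  "(\<Sum>n<N. c\<^sub>0 / \<Delta>t * (nrm \<Omega> (\<lambda>x. p (Suc n) x - p n x))\<^sup>2) \<le> 1 / (2 * k_min) * (nrm \<Omega> (z 0))\<^sup>2"
proof -
  have "0 \<le> 1 / (2 * \<Delta>t) * A.form (pressure_stress_inc N) (pressure_stress_inc N)" "0 \<le> Kinv.form (z N) (z N)"
    using dt by (simp_all add: A.form_nonneg Kinv.form_nonneg L2_increments L2_members)
  then have "(\<Sum>n<N. c\<^sub>0 / \<Delta>t * (nrm \<Omega> (pressure_inc (Suc n)))\<^sup>2) \<le> 1 / 2 * Kinv.form (z 0) (z 0)"
    using energy_estimate[of N] by linarith
  also have "\<dots> \<le> 1 / 2 * (1 / k_min * (nrm \<Omega> (z 0))\<^sup>2)"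
    using Kinv.form_upper[of "z 0"] L2_members[of 0] by simp
  finally show ?thesis by (simp add: pressure_inc_def[abs_def])
qed

text \<open>By the Darcy equation the inf-sup quotient of \<open>p\<^sup>k\<close> is \<open>(K\<^sup>-\<^sup>1 z\<^sup>k, q)\<close> divided by the norm of \<open>q\<close>, so the
  flux controls the pressure independently of \<open>c\<^sub>0\<close>.\<close>

lemma pressure_bound:
  assumes "inf_sup_flow \<Omega> Zh Wh C" "0 \<le> C" "k \<le> N"
  shows "(nrm \<Omega> (p k))\<^sup>2 \<le> (C / k_min)\<^sup>2 * (k_max / k_min) * (nrm \<Omega> (z 0))\<^sup>2"
proof -
  have "nrm \<Omega> (p k) \<le> C * (1 / k_min * nrm \<Omega> (z k))"
  proof (rule inf_sup_flow_bound[OF assms(1,2) feW members(5)[OF assms(3)]])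
    fix q assume q: "q \<in> Zh"
    then have "q \<in> L2 \<Omega>" using Z Z_space_L2 by blast
    have "ip \<Omega> (wdiv \<Omega> q) (p k) = Kinv.form (z k) q"
      by (simp add: darcy_equation[OF assms(3) q] ip_commute)
    also have "\<dots> \<le> sqrt (Kinv.form (z k) (z k)) * (sqrt (1 / k_min) * nrm \<Omega> q)"
      using Kinv.form_le_norms[OF L2_members(2)[OF assms(3)] \<open>q \<in> L2 \<Omega>\<close>] by linarith
    also have "\<dots> \<le> sqrt (1 / k_min * (nrm \<Omega> (z k))\<^sup>2) * (sqrt (1 / k_min) * nrm \<Omega> q)"
      using k_min Kinv.form_upper[OF L2_members(2)[OF assms(3)]]
      by (intro mult_right_mono real_sqrt_le_mono) (simp_all add: nrm_nonneg)
    also have "\<dots> = (sqrt (1 / k_min) * sqrt (1 / k_min)) * nrm \<Omega> (z k) * nrm \<Omega> q"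
      by (simp only: real_sqrt_mult real_sqrt_abs abs_of_nonneg nrm_nonneg ac_simps)
    also have "\<dots> = 1 / k_min * nrm \<Omega> (z k) * nrm \<Omega> q"
      using k_min by simp
    finally show "ip \<Omega> (wdiv \<Omega> q) (p k) \<le> 1 / k_min * nrm \<Omega> (z k) * nrm \<Omega> q" .
  qed (use k_min in \<open>simp add: nrm_nonneg\<close>)
  then have "(nrm \<Omega> (p k))\<^sup>2 \<le> (C / k_min * nrm \<Omega> (z k))\<^sup>2"
    by (intro power_mono nrm_nonneg) simp
  also have "\<dots> \<le> (C / k_min)\<^sup>2 * (k_max / k_min * (nrm \<Omega> (z 0))\<^sup>2)"
    unfolding power_mult_distrib by (intro mult_left_mono flux_bound assms) simp
  finally show ?thesis by (simp only: mult.assoc)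
qed

lemma pressure_stress_bound:
  assumes "k \<le> N"
  shows "A.form (pressure_stress k) (pressure_stress k) \<le> a_max * (\<alpha>\<^sup>2 * CARD('n) * (nrm \<Omega> (p k))\<^sup>2)"
proof -
  have "(nrm \<Omega> (pressure_stress k))\<^sup>2 = \<alpha>\<^sup>2 * CARD('n) * (nrm \<Omega> (p k))\<^sup>2"
    by (simp only: pressure_stress_def[abs_def] nrm_mult_mat_1)
  with A.form_upper[OF L2_pressure_stress[OF assms]] show ?thesis by simp
qed

lemma stress_le_pressure:
  assumes "k \<le> N"
  shows "A.form (\<sigma> k) (\<sigma> k) \<le> A.form (pressure_stress (k - 1)) (pressure_stress (k - 1))"
proof -
  have "k - 1 \<le> N" using assms by simp
  from A.form_young[OF L2_pressure_stress[OF this] L2_members(1)[OF assms]] stress_tested_with_stress[OF assms assms]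
  show ?thesis by linarith
qed

text \<open>The stress equation expresses the inf-sup quotient by the stress and the lagged pressure, whose energy
  norms are both at most that of the pressure stress.\<close>

lemma displacement_rotation_bound:
  assumes "inf_sup_elasticity \<Omega> Xh Vh Qh C" "0 \<le> C" "k \<le> N"
  shows "(nrm \<Omega> (u k))\<^sup>2 + (nrm \<Omega> (\<gamma> k))\<^sup>2 \<le> 4 * C\<^sup>2 * a_max * A.form (pressure_stress (k - 1)) (pressure_stress (k - 1))"
proof -
  let ?s = "sqrt (A.form (pressure_stress (k - 1)) (pressure_stress (k - 1)))"
  have pressure_stress: "pressure_stress (k - 1) \<in> L2 \<Omega>" using assms(3) by (simp add: L2_pressure_stress)
  have "nrm \<Omega> (u k) + nrm \<Omega> (\<gamma> k) \<le> C * (2 * sqrt a_max * ?s)"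
  proof (rule inf_sup_elasticity_bound[OF assms(1,2) feV _ feQ])
    fix \<tau> assume \<tau>: "\<tau> \<in> Xh"
    then have L2: "\<tau> \<in> L2 \<Omega>" using X X_space_L2 by blast
    have "ip \<Omega> (u k) (mdiv \<Omega> \<tau>) + ip \<Omega> (\<gamma> k) \<tau> = - A.form (pressure_stress (k - 1)) \<tau> - A.form (\<sigma> k) \<tau>"
      using stress_equation[OF assms(3) \<tau>] by simp
    also have "\<dots> \<le> ?s * (sqrt a_max * nrm \<Omega> \<tau>) + sqrt (A.form (\<sigma> k) (\<sigma> k)) * (sqrt a_max * nrm \<Omega> \<tau>)"
      using A.form_le_norms[OF pressure_stress L2] A.form_le_norms[OF L2_members(1)[OF assms(3)] L2] by linarith
    also have "\<dots> \<le> ?s * (sqrt a_max * nrm \<Omega> \<tau>) + ?s * (sqrt a_max * nrm \<Omega> \<tau>)"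
      using A.M_nonneg
      by (intro add_left_mono mult_right_mono real_sqrt_le_mono stress_le_pressure assms)
         (simp add: nrm_nonneg)
    finally show "ip \<Omega> (u k) (mdiv \<Omega> \<tau>) + ip \<Omega> (\<gamma> k) \<tau> \<le> 2 * sqrt a_max * ?s * nrm \<Omega> \<tau>"
      by (simp add: mult_ac)
  qed (use assms A.M_nonneg pressure_stress in \<open>simp_all add: members A.form_nonneg\<close>)
  then have "(nrm \<Omega> (u k) + nrm \<Omega> (\<gamma> k))\<^sup>2 \<le> (C * (2 * sqrt a_max * ?s))\<^sup>2"
    by (intro power_mono) (simp_all add: nrm_nonneg)
  also have "\<dots> = 4 * C\<^sup>2 * a_max * A.form (pressure_stress (k - 1)) (pressure_stress (k - 1))"
    using A.M_nonneg A.form_nonneg[OF pressure_stress] by (simp add: power_mult_distrib)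
  moreover have "(nrm \<Omega> (u k))\<^sup>2 + (nrm \<Omega> (\<gamma> k))\<^sup>2 \<le> (nrm \<Omega> (u k) + nrm \<Omega> (\<gamma> k))\<^sup>2"
    by (simp add: power2_sum nrm_nonneg)
  ultimately show ?thesis by linarith
qed

end

theorem theorem4p1:
  fixes \<Omega> \<Gamma>Du \<Gamma>N\<sigma> \<Gamma>Dp \<Gamma>Nz :: "(real ^ 'n) set"
    and K :: "real ^ 'n \<Rightarrow> real ^ 'n ^ 'n"
    and \<alpha> T a_max k_min k_max :: real
    and H :: "real set"
    and \<T> :: "real \<Rightarrow> (real ^ 'n) set set"
    and Xh Qh :: "real \<Rightarrow> (real ^ 'n \<Rightarrow> real ^ 'n ^ 'n) set"
    and Vh Zh :: "real \<Rightarrow> (real ^ 'n \<Rightarrow> real ^ 'n) set"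
    and Wh :: "real \<Rightarrow> (real ^ 'n \<Rightarrow> real) set"
  assumes dim: "CARD('n) = 2 \<or> CARD('n) = 3"
    and domain: "polygonal_domain \<Omega>"
    and boundary: "\<Gamma>Du \<union> \<Gamma>N\<sigma> = frontier \<Omega>" "\<Gamma>Dp \<union> \<Gamma>Nz = frontier \<Omega>"
    and alpha: "0 < \<alpha>" "\<alpha> \<le> 1"
    and final_time: "0 < T"
    and a_max: "0 < a_max"
    and k_bounds: "0 < k_min" "k_min \<le> k_max"
    and permeability: "permeability_tensor \<Omega> (Z_space \<Omega> \<Gamma>Nz) k_min k_max K"
    and partitions: "partition_family \<Omega> H \<T>" "shape_regular H \<T>" "quasi_uniform H \<T>"
    and fe_spaces: "\<forall>h\<in>H. fe_space (\<T> h) (Xh h) \<and> fe_space (\<T> h) (Vh h) \<and> fe_space (\<T> h) (Qh h) \<and>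
                          fe_space (\<T> h) (Zh h) \<and> fe_space (\<T> h) (Wh h)"
    and conforming: "\<forall>h\<in>H. Xh h \<subseteq> X_space \<Omega> \<Gamma>N\<sigma> \<and> Vh h \<subseteq> L2 \<Omega> \<and> Qh h \<subseteq> Q_space \<Omega> \<and>
                          Zh h \<subseteq> Z_space \<Omega> \<Gamma>Nz \<and> Wh h \<subseteq> L2 \<Omega>"
    and inf_sup1: "\<exists>C>0. \<forall>h\<in>H. inf_sup_elasticity \<Omega> (Xh h) (Vh h) (Qh h) C"
    and inf_sup2: "\<exists>C>0. \<forall>h\<in>H. inf_sup_flow \<Omega> (Zh h) (Wh h) C"
  shows "\<exists>C>0. \<forall>h\<in>H. \<forall>N::nat. \<forall>\<Delta>t c\<^sub>0 a_min A \<sigma> u \<gamma> z p.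
           1 \<le> N \<longrightarrow> \<Delta>t = T / real N \<longrightarrow> 0 \<le> c\<^sub>0 \<longrightarrow> 0 < a_min \<longrightarrow> a_min \<le> a_max \<longrightarrow>
           compliance_tensor \<Omega> (X_space \<Omega> \<Gamma>N\<sigma>) a_min a_max A \<longrightarrow>
           drained_split_solution \<Omega> A K \<alpha> c\<^sub>0 \<Delta>t N (Xh h) (Vh h) (Qh h) (Zh h) (Wh h) \<sigma> u \<gamma> z p \<longrightarrow>
           (\<Sum>n<N. c\<^sub>0 / \<Delta>t * (nrm \<Omega> (\<lambda>x. p (Suc n) x - p n x))\<^sup>2)
           + (MAX n\<in>{..<N}. (nrm \<Omega> (z (Suc n)))\<^sup>2 + (nrm \<Omega> (p (Suc n)))\<^sup>2
                + (nrm \<Omega> (\<lambda>x. op_sqrt (A x) (\<sigma> (Suc n) x)))\<^sup>2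
                + (nrm \<Omega> (u (Suc n)))\<^sup>2 + (nrm \<Omega> (\<gamma> (Suc n)))\<^sup>2)
           \<le> C * ((nrm \<Omega> (p 0))\<^sup>2 + (nrm \<Omega> (z 0))\<^sup>2)"
proof -
  obtain C\<^sub>e where C\<^sub>e: "0 < C\<^sub>e" "\<forall>h\<in>H. inf_sup_elasticity \<Omega> (Xh h) (Vh h) (Qh h) C\<^sub>e"
    using inf_sup1 by blast
  obtain C\<^sub>p where C\<^sub>p: "0 < C\<^sub>p" "\<forall>h\<in>H. inf_sup_flow \<Omega> (Zh h) (Wh h) C\<^sub>p"
    using inf_sup2 by blast
  have \<Omega>: "open \<Omega>" "bounded \<Omega>"
    using domain by (auto simp: polygonal_domain_def)
  have k_max: "0 < k_max" using k_bounds by linarith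
  have Kinv: "coefficient_field \<Omega> (1 / k_max) (1 / k_min) (\<lambda>x v. matrix_inv (K x) *v v)"
    using permeability
    by (intro coefficient_field_matrix_inv permeability_coefficient_field[OF \<Omega> k_bounds permeability]
        k_bounds k_max) (simp add: permeability_tensor_def)
  \<comment> \<open>The constants bound, in units of \<open>\<parallel>z\<^sup>0\<parallel>\<^sup>2\<close>, the pressure, the stress, and displacement with rotation. None of
    them involves \<open>h\<close>, \<open>\<Delta>t\<close>, \<open>c\<^sub>0\<close> or \<open>a_min\<close>.\<close>
  define C1 where "C1 = (C\<^sub>p / k_min)\<^sup>2 * (k_max / k_min)"
  define C2 where "C2 = a_max * (\<alpha>\<^sup>2 * CARD('n) * C1)"
  define C3 where "C3 = 4 * C\<^sub>e\<^sup>2 * a_max * C2"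
  define C where "C = 1 / (2 * k_min) + (k_max / k_min + C1 + C2 + C3)"
  have pos: "0 < C1" "0 < C2" "0 < C3"
    using C\<^sub>p C\<^sub>e k_bounds k_max a_max alpha by (simp_all add: C1_def C2_def C3_def)
  have "0 < C" using pos k_bounds k_max by (simp add: C_def add_pos_pos)
  show ?thesis
  proof (intro exI[of _ C] conjI ballI allI impI)
    show "0 < C" by fact
    fix h N \<Delta>t c\<^sub>0 a_min A \<sigma> u \<gamma> z p
    assume h: "h \<in> H" and N: "1 \<le> N" and \<Delta>t: "\<Delta>t = T / real N" and c\<^sub>0: "0 \<le> (c\<^sub>0 :: real)"
      and a: "0 < a_min" "a_min \<le> a_max"
      and A: "compliance_tensor \<Omega> (X_space \<Omega> \<Gamma>N\<sigma>) a_min a_max A"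
      and sol: "drained_split_solution \<Omega> A K \<alpha> c\<^sub>0 \<Delta>t N (Xh h) (Vh h) (Qh h) (Zh h) (Wh h) \<sigma> u \<gamma> z p"
    interpret drained_split \<Omega> A K \<alpha> c\<^sub>0 \<Delta>t a_min a_max k_min k_max N
      "Xh h" "Vh h" "Qh h" "Zh h" "Wh h" \<sigma> u \<gamma> z p \<Gamma>N\<sigma> \<Gamma>Nz "\<T> h"
    proof (rule drained_split.intro)
      show "coefficient_field \<Omega> a_min a_max A"
        by (rule compliance_coefficient_field[OF \<Omega> a A])
      show "0 < \<Delta>t" using final_time N by (simp add: \<Delta>t)
      show "Qh h \<subseteq> L2 \<Omega>" using conforming h by (auto simp: Q_space_def)
    qed (use conforming fe_spaces h Kinv k_bounds k_max c\<^sub>0 sol in simp_all)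
    let ?Z = "(nrm \<Omega> (z 0))\<^sup>2"
    have level_bound: "(nrm \<Omega> (z (Suc n)))\<^sup>2 + (nrm \<Omega> (p (Suc n)))\<^sup>2
          + (nrm \<Omega> (\<lambda>x. op_sqrt (A x) (\<sigma> (Suc n) x)))\<^sup>2
          + (nrm \<Omega> (u (Suc n)))\<^sup>2 + (nrm \<Omega> (\<gamma> (Suc n)))\<^sup>2
        \<le> (k_max / k_min + C1 + C2 + C3) * ?Z" if "n < N" for n
    proof -
      have le: "Suc n \<le> N" "n \<le> N" using that by auto
      have p: "(nrm \<Omega> (p k))\<^sup>2 \<le> C1 * ?Z" if "k \<le> N" for k
        unfolding C1_def using C\<^sub>p h that by (intro pressure_bound) auto
      have "A.form (pressure_stress n) (pressure_stress n) \<le> a_max * (\<alpha>\<^sup>2 * CARD('n) * (nrm \<Omega> (p n))\<^sup>2)"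
        by (rule pressure_stress_bound[OF le(2)])
      also have "\<dots> \<le> a_max * (\<alpha>\<^sup>2 * CARD('n) * (C1 * ?Z))"
        using a_max by (intro mult_left_mono p le) auto
      finally have pressure_stress: "A.form (pressure_stress n) (pressure_stress n) \<le> C2 * ?Z"
        by (simp only: C2_def mult.assoc)
      have \<sigma>: "(nrm \<Omega> (\<lambda>x. op_sqrt (A x) (\<sigma> (Suc n) x)))\<^sup>2 \<le> C2 * ?Z"
        using A.nrm_op_sqrt[OF L2_members(1)[OF le(1)]] stress_le_pressure[OF le(1)] pressure_stress by simp
      have "(nrm \<Omega> (u (Suc n)))\<^sup>2 + (nrm \<Omega> (\<gamma> (Suc n)))\<^sup>2 \<le> 4 * C\<^sub>e\<^sup>2 * a_max * A.form (pressure_stress n) (pressure_stress n)"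
        using displacement_rotation_bound[OF _ _ le(1), of C\<^sub>e] C\<^sub>e h by simp
      also have "\<dots> \<le> 4 * C\<^sub>e\<^sup>2 * a_max * (C2 * ?Z)"
        using a_max by (intro mult_left_mono pressure_stress) simp
      finally have "(nrm \<Omega> (u (Suc n)))\<^sup>2 + (nrm \<Omega> (\<gamma> (Suc n)))\<^sup>2 \<le> C3 * ?Z"
        by (simp only: C3_def mult.assoc)
      with flux_bound[OF le(1)] p[OF le(1)] \<sigma> show ?thesis
        by (simp only: distrib_right)
    qed
    have "(MAX n\<in>{..<N}. (nrm \<Omega> (z (Suc n)))\<^sup>2 + (nrm \<Omega> (p (Suc n)))\<^sup>2
          + (nrm \<Omega> (\<lambda>x. op_sqrt (A x) (\<sigma> (Suc n) x)))\<^sup>2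
          + (nrm \<Omega> (u (Suc n)))\<^sup>2 + (nrm \<Omega> (\<gamma> (Suc n)))\<^sup>2)
        \<le> (k_max / k_min + C1 + C2 + C3) * ?Z"
      using N level_bound by (subst Max_le_iff) (auto simp: lessThan_empty_iff)
    with storage_bound
    have "(\<Sum>n<N. c\<^sub>0 / \<Delta>t * (nrm \<Omega> (\<lambda>x. p (Suc n) x - p n x))\<^sup>2)
        + (MAX n\<in>{..<N}. (nrm \<Omega> (z (Suc n)))\<^sup>2 + (nrm \<Omega> (p (Suc n)))\<^sup>2
          + (nrm \<Omega> (\<lambda>x. op_sqrt (A x) (\<sigma> (Suc n) x)))\<^sup>2
          + (nrm \<Omega> (u (Suc n)))\<^sup>2 + (nrm \<Omega> (\<gamma> (Suc n)))\<^sup>2)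
        \<le> C * ?Z"
      unfolding C_def distrib_right[of "1 / (2 * k_min)"] by (rule add_mono)
    also have "\<dots> \<le> C * ((nrm \<Omega> (p 0))\<^sup>2 + ?Z)"
      using \<open>0 < C\<close> by simp
    finally show "(\<Sum>n<N. c\<^sub>0 / \<Delta>t * (nrm \<Omega> (\<lambda>x. p (Suc n) x - p n x))\<^sup>2)
        + (MAX n\<in>{..<N}. (nrm \<Omega> (z (Suc n)))\<^sup>2 + (nrm \<Omega> (p (Suc n)))\<^sup>2
          + (nrm \<Omega> (\<lambda>x. op_sqrt (A x) (\<sigma> (Suc n) x)))\<^sup>2
          + (nrm \<Omega> (u (Suc n)))\<^sup>2 + (nrm \<Omega> (\<gamma> (Suc n)))\<^sup>2)
        \<le> C * ((nrm \<Omega> (p 0))\<^sup>2 + (nrm \<Omega> (z 0))\<^sup>2)" .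
  qed
qed

end
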